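(* Let $K\subset\mathbb{R}^d$ be the attractor of a contracting iterated function system $\{f_1,\dots,f_k\}$, equipped with a stationary Borel probability measure $\nu$. Let $W\in L^2(K\times K,\nu\times\nu)$ be real-valued with $$\bar W:=\max\Big\{\operatorname*{ess\,sup}_{x\in K}\int_K|W(x,y)|\,d\nu(y),\ \operatorname*{ess\,sup}_{y\in K}\int_K|W(x,y)|\,d\nu(x)\Big\}<\infty .$$ Let $f:\mathbb{R}\times\mathbb{R}^q\to\mathbb{R}^q$ and $D:\mathbb{R}^q\times\mathbb{R}^q\to\mathbb{R}^q$ be jointly continuous and suppose that for some constants $L_f,L_D>0$ $$|f(t,u)-f(t,u')|\le L_f|u-u'|,\qquad |D(u,v)-D(u',v')|\le L_D(|u-u'|+|v-v'|)$$ for all $t\in\mathbb{R}$ and $u,u',v,v'\in\mathbb{R}^q$, and that $\sup_{u,v}|D(u,v)|\le 1$. Let $g\in L^2(K,\nu)$ (with values in $\mathbb{R}^q$). Then for any $T>0$ the initial value problem $$\partial_t u(t,x)=f(t,u(t,x))+\int_K W(x,y)\,D\big(u(t,x),u(t,y)\big)\,d\nu(y),\qquad u(0,x)=g(x),\quad x\in K,$$ has a unique solution $u\in C([-T,T];L^2(K,\nu))$.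
   Context: A contracting iterated function system (IFS) on $\mathbb{R}^d$ is a finite family of injective maps $f_i:\mathbb{R}^d\to\mathbb{R}^d$, $i\in[k]=\{1,\dots,k\}$, with $|f_i(x)-f_i(y)|\le r_i|x-y|$ for some $0<r_i<1$, whose fixed points are not all identical. Its attractor is the unique nonempty compact set $K$ with $K=\bigcup_{i\in[k]}f_i(K)$. A Borel probability measure $\nu$ on $K$ is stationary if, for some probability vector $p=(p_1,\dots,p_k)$ with all $p_i>0$ and $\sum_i p_i=1$, $\nu(A)=\sum_{j=1}^k p_j\,\nu(f_j^{-1}(A))$ for all Borel $A\subset K$. The function $f(t,u)$ in the evolution equation is unrelated to the maps $f_i$ of the IFS. The evolution equation is understood as a differential equation for $t\mapsto u(t,\cdot)$ in the Banach space $L^2(K,\nu)=L^2(K,\nu;\mathbb{R}^q)$. *)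

theory Defs
  imports "HOL-Probability.Probability"
begin

section \<open>Iterated function systems\<close>

text \<open>The maps are indexed by \<open>{1..k}\<close>; values of \<open>S\<close> at other indices are irrelevant.\<close>

definition contracting_ifs :: "nat \<Rightarrow> (nat \<Rightarrow> real ^ 'd \<Rightarrow> real ^ 'd) \<Rightarrow> bool" where
  "contracting_ifs k S \<longleftrightarrow>
     (\<forall>i\<in>{1..k}. inj (S i) \<and>
        (\<exists>r. 0 < r \<and> r < 1 \<and> (\<forall>x y. norm (S i x - S i y) \<le> r * norm (x - y)))) \<and>
     (\<exists>i\<in>{1..k}. \<exists>j\<in>{1..k}. \<exists>x y. S i x = x \<and> S j y = y \<and> x \<noteq> y)"

definition is_attractor :: "nat \<Rightarrow> (nat \<Rightarrow> real ^ 'd \<Rightarrow> real ^ 'd) \<Rightarrow> (real ^ 'd) set \<Rightarrow> bool" where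
  "is_attractor k S K \<longleftrightarrow> K \<noteq> {} \<and> compact K \<and> K = (\<Union>i\<in>{1..k}. S i ` K)"

text \<open>The predicate \<open>is_attractor\<close> determines the set, so that it is legitimate to
  speak of \<^emph>\<open>the\<close> attractor.\<close>

lemma is_attractor_subset:
  assumes ifs: "contracting_ifs k S" and K: "is_attractor k S K" and L: "is_attractor k S L"
  shows "K \<subseteq> L"
proof -
  have "continuous_on K (\<lambda>x. infdist x L)"
    by (intro continuous_intros)
  then obtain x0 where x0: "x0 \<in> K" "\<And>x. x \<in> K \<Longrightarrow> infdist x L \<le> infdist x0 L"
    using K continuous_attains_sup[of K "\<lambda>x. infdist x L"] unfolding is_attractor_def by blast
  obtain i y where iy: "i \<in> {1..k}" "y \<in> K" "x0 = S i y"
    using K x0(1) unfolding is_attractor_def by blast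
  obtain r where r: "0 < r" "r < 1" "\<And>x y. norm (S i x - S i y) \<le> r * norm (x - y)"
    using ifs iy(1) unfolding contracting_ifs_def by meson
  have "compact L" "L \<noteq> {}"
    using L by (auto simp: is_attractor_def)
  then obtain z where z: "z \<in> L" "infdist y L = dist y z"
    using infdist_attains_inf[of L y] compact_imp_closed by blast
  have "S i z \<in> L"
    using L z(1) iy(1) unfolding is_attractor_def by blast
  then have "infdist x0 L \<le> dist (S i y) (S i z)"
    unfolding iy(3) by (rule infdist_le)
  also have "\<dots> \<le> r * infdist y L"
    using r(3) by (simp add: dist_norm z(2))
  also have "\<dots> \<le> r * infdist x0 L"
    using r(1) x0(2) iy(2) by simp
  finally have "(1 - r) * infdist x0 L \<le> 0"
    by (simp add: algebra_simps)
  then have "infdist x0 L \<le> 0"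
    using r(2) by (simp add: mult_le_0_iff)
  then have "infdist x L = 0" if "x \<in> K" for x
    using x0(2)[OF that] infdist_nonneg[of x L] by linarith
  then show ?thesis
    using \<open>compact L\<close> \<open>L \<noteq> {}\<close> in_closed_iff_infdist_zero compact_imp_closed by blast
qed

lemma is_attractor_unique:
  assumes "contracting_ifs k S" "is_attractor k S K" "is_attractor k S L"
  shows "K = L"
  using is_attractor_subset assms by blast

text \<open>A Borel probability measure on \<open>K\<close> is a measure whose underlying space is \<open>K\<close>
  itself, hence the preimages are intersected with \<open>K\<close>.\<close>

definition stationary_measure ::
    "nat \<Rightarrow> (nat \<Rightarrow> real ^ 'd \<Rightarrow> real ^ 'd) \<Rightarrow> (real ^ 'd) set \<Rightarrow> (real ^ 'd) measure \<Rightarrow> bool" where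
  "stationary_measure k S K \<nu> \<longleftrightarrow>
     sets \<nu> = sets (restrict_space borel K) \<and> prob_space \<nu> \<and>
     (\<exists>p :: nat \<Rightarrow> real. (\<forall>j\<in>{1..k}. 0 < p j) \<and> (\<Sum>j=1..k. p j) = 1 \<and>
        (\<forall>A\<in>sets \<nu>. measure \<nu> A = (\<Sum>j=1..k. p j * measure \<nu> (S j -` A \<inter> K))))"


section \<open>Curves in \<open>L\<^sup>2\<close>\<close>

text \<open>Elements of \<open>L\<^sup>2\<close> are handled through representatives; equality in \<open>L\<^sup>2\<close> is
  equality almost everywhere. Values of representatives outside \<open>space M\<close> are irrelevant.\<close>

definition L2 :: "'a measure \<Rightarrow> ('a \<Rightarrow> 'b::euclidean_space) set" where
  "L2 M = {h \<in> borel_measurable M. integrable M (\<lambda>x. (norm (h x))\<^sup>2)}"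

text \<open>Meaningful only on \<open>L2 M\<close>: the Bochner integral of a non-integrable function is \<open>0\<close>.\<close>

definition norm_L2 :: "'a measure \<Rightarrow> ('a \<Rightarrow> 'b::euclidean_space) \<Rightarrow> real" where
  "norm_L2 M h = sqrt (\<integral>x. (norm (h x))\<^sup>2 \<partial>M)"

definition continuous_on_L2 ::
    "'a measure \<Rightarrow> real set \<Rightarrow> (real \<Rightarrow> 'a \<Rightarrow> 'b::euclidean_space) \<Rightarrow> bool" where
  "continuous_on_L2 M I u \<longleftrightarrow>
     (\<forall>t\<in>I. u t \<in> L2 M) \<and>
     (\<forall>t\<in>I. ((\<lambda>s. norm_L2 M (\<lambda>x. u s x - u t x)) \<longlongrightarrow> 0) (at t within I))"

text \<open>For \<open>u\<close> with values in \<open>L2 M\<close> on \<open>I\<close>: \<open>v\<close> is the derivative of \<open>t \<mapsto> u t\<close> at \<open>t\<close>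
  with respect to the \<open>L\<^sup>2\<close> norm (one-sided if \<open>t\<close> is an endpoint of the interval \<open>I\<close>).\<close>

definition has_L2_derivative ::
    "'a measure \<Rightarrow> (real \<Rightarrow> 'a \<Rightarrow> 'b::euclidean_space) \<Rightarrow> ('a \<Rightarrow> 'b) \<Rightarrow> real \<Rightarrow> real set \<Rightarrow> bool" where
  "has_L2_derivative M u v t I \<longleftrightarrow>
     v \<in> L2 M \<and>
     ((\<lambda>s. norm_L2 M (\<lambda>x. (u s x - u t x) /\<^sub>R (s - t) - v x)) \<longlongrightarrow> 0) (at t within I)"


section \<open>The evolution equation\<close>

definition W_bar :: "'a measure \<Rightarrow> ('a \<times> 'a \<Rightarrow> real) \<Rightarrow> ennreal" where
  "W_bar \<nu> W = max (esssup \<nu> (\<lambda>x. \<integral>\<^sup>+ y. ennreal \<bar>W (x, y)\<bar> \<partial>\<nu>))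
                   (esssup \<nu> (\<lambda>y. \<integral>\<^sup>+ x. ennreal \<bar>W (x, y)\<bar> \<partial>\<nu>))"

definition ivp_solution ::
    "'a measure \<Rightarrow> ('a \<times> 'a \<Rightarrow> real) \<Rightarrow> (real \<Rightarrow> 'b \<Rightarrow> 'b) \<Rightarrow> ('b \<Rightarrow> 'b \<Rightarrow> 'b) \<Rightarrow> ('a \<Rightarrow> 'b)
      \<Rightarrow> real \<Rightarrow> (real \<Rightarrow> 'a \<Rightarrow> 'b::euclidean_space) \<Rightarrow> bool" where
  "ivp_solution \<nu> W f D g T u \<longleftrightarrow>
     continuous_on_L2 \<nu> {-T..T} u \<and>
     (\<forall>t\<in>{-T..T}. has_L2_derivative \<nu> u
        (\<lambda>x. f t (u t x) + (\<integral>y. W (x, y) *\<^sub>R D (u t x) (u t y) \<partial>\<nu>)) t {-T..T}) \<and>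
     (AE x in \<nu>. u 0 x = g x)"

end

theory Submission
  imports Defs
begin

text \<open>
  Write \<open>F t h x = f t (h x) + \<integral> W (x, y) D (h x) (h y) d\<nu>(y)\<close> for the right-hand side. Since \<open>D\<close>
  is bounded and Lipschitz and the row integrals of \<open>\<bar>W\<bar>\<close> are bounded by a constant \<open>Wb\<close>, the
  Cauchy--Schwarz inequality gives, for almost every \<open>x\<close> and all square-integrable \<open>h\<close> and \<open>h'\<close>,
  the pointwise estimate \<open>velocity_Lipschitz\<close>:
  \<open>|F t h x - F t h' x| \<le> (L_f + L_D Wb) |h x - h' x| + L_D w x \<parallel>h - h'\<parallel>\<close>,
  where \<open>w x\<close> is the norm of \<open>W (x, \<cdot>)\<close> and is itself a square-integrable function of \<open>x\<close>.

  Uniqueness. The squared norm \<open>E\<close> of the difference of two solutions is differentiable in time,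
  and the estimate gives \<open>|E'| \<le> 2 B E\<close> for a constant \<open>B\<close>. As \<open>E 0 = 0\<close>, Gronwall's argument shows
  \<open>E = 0\<close> (\<open>ivp_solution_unique\<close>).

  Existence. Rather than iterating in the Banach space of square-integrable classes, the proof iterates
  pointwise, with the weight \<open>\<phi> x = 1 + |g x| + w x\<close>. A bound \<open>|h - h'| \<le> c \<phi>\<close> implies
  \<open>\<parallel>h - h'\<parallel> \<le> c \<parallel>\<phi>\<parallel>\<close>, hence \<open>|F t h x - F t h' x| \<le> A c \<phi> x\<close> for a constant \<open>A\<close>. So \<open>F\<close> is Lipschitz in
  the supremum norm weighted by \<open>\<phi>\<close>, and the increments of the Picard iterates are at most
  \<open>(A |t|)^(n+1) / (n+1)! * \<phi> x\<close> (\<open>picard_increment\<close>). For each \<open>x\<close> the iterates converge locally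
  uniformly in \<open>t\<close>, and for almost every \<open>x\<close> the limit satisfies the equation classically in \<open>t\<close>. All
  quantities involved are dominated by multiples of the square-integrable function \<open>\<phi>\<close>, so dominated
  convergence upgrades the classical solution to a solution in the sense of \<open>L\<^sup>2\<close>
  (\<open>ivp_solution_solution\<close>).
\<close>

section \<open>The space of square-integrable functions\<close>

lemma norm_integral_le:
  fixes h :: "'a \<Rightarrow> 'b::euclidean_space"
  assumes "integrable M h" "integrable M k" "\<And>x. norm (h x) \<le> k x"
  shows "norm (\<integral>x. h x \<partial>M) \<le> (\<integral>x. k x \<partial>M)"
  by (rule order_trans[OF integral_norm_bound integral_mono]) (use assms in auto)

lemma L2_add:
  fixes h k :: "'a \<Rightarrow> 'b::euclidean_space"
  assumes "h \<in> L2 M" "k \<in> L2 M"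
  shows "(\<lambda>x. h x + k x) \<in> L2 M"
proof -
  have [measurable]: "h \<in> borel_measurable M" "k \<in> borel_measurable M"
    using assms by (auto simp: L2_def)
  have "(norm (a + b))\<^sup>2 \<le> 2 * (norm a)\<^sup>2 + 2 * (norm b)\<^sup>2" for a b :: 'b
  proof -
    have "(norm (a + b))\<^sup>2 \<le> (norm a + norm b)\<^sup>2"
      by (intro power_mono norm_triangle_ineq) auto
    also have "\<dots> \<le> 2 * (norm a)\<^sup>2 + 2 * (norm b)\<^sup>2"
      using sum_squares_bound[of "norm a" "norm b"] by (simp add: power2_sum)
    finally show ?thesis .
  qed
  moreover have "integrable M (\<lambda>x. 2 * (norm (h x))\<^sup>2 + 2 * (norm (k x))\<^sup>2)"
    using assms by (auto simp: L2_def)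
  ultimately have "integrable M (\<lambda>x. (norm (h x + k x))\<^sup>2)"
    by (intro Bochner_Integration.integrable_bound[where g="\<lambda>x. (norm (h x + k x))\<^sup>2"
          and f="\<lambda>x. 2 * (norm (h x))\<^sup>2 + 2 * (norm (k x))\<^sup>2"]) auto
  then show ?thesis
    by (simp add: L2_def)
qed

lemma L2_scaleR: "h \<in> L2 M \<Longrightarrow> (\<lambda>x. c *\<^sub>R h x) \<in> L2 M"
  by (auto simp: L2_def power_mult_distrib)

lemma L2_diff:
  assumes "h \<in> L2 M" "k \<in> L2 M"
  shows "(\<lambda>x. h x - k x) \<in> L2 M"
  using L2_add[OF assms(1) L2_scaleR[OF assms(2), of "-1"]] by simp

lemma L2_norm: "h \<in> L2 M \<Longrightarrow> (\<lambda>x. norm (h x)) \<in> L2 M"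
  by (auto simp: L2_def)

lemma L2_dominated:
  assumes "\<phi> \<in> L2 M" "h \<in> borel_measurable M" "AE x in M. norm (h x) \<le> norm (\<phi> x)"
  shows "h \<in> L2 M"
  using assms unfolding L2_def
  by (auto elim!: Bochner_Integration.integrable_bound intro: power_mono)

lemma (in finite_measure) L2_const: "(\<lambda>x. c) \<in> L2 M"
  by (simp add: L2_def)

lemma norm_L2_nonneg: "0 \<le> norm_L2 M h"
  by (simp add: norm_L2_def)

lemma norm_L2_power2: "(norm_L2 M h)\<^sup>2 = (\<integral>x. (norm (h x))\<^sup>2 \<partial>M)"
  by (simp add: norm_L2_def)

lemma norm_L2_mono:
  assumes "\<phi> \<in> L2 M" "h \<in> borel_measurable M" "AE x in M. norm (h x) \<le> norm (\<phi> x)"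
  shows "norm_L2 M h \<le> norm_L2 M \<phi>"
proof -
  have "integrable M (\<lambda>x. (norm (h x))\<^sup>2)" "integrable M (\<lambda>x. (norm (\<phi> x))\<^sup>2)"
    using L2_dominated[OF assms] assms(1) by (auto simp: L2_def)
  then show ?thesis
    unfolding norm_L2_def using assms(3)
    by (intro real_sqrt_le_mono integral_mono_AE) (auto elim: eventually_mono intro: power_mono)
qed

lemma integrable_norm_mult_norm_L2:
  assumes "h \<in> L2 M" "k \<in> L2 M"
  shows "integrable M (\<lambda>x. norm (h x) * norm (k x))"
proof (rule Bochner_Integration.integrable_bound)
  show "integrable M (\<lambda>x. (norm (h x))\<^sup>2 + (norm (k x))\<^sup>2)"
    using assms by (auto simp: L2_def)
  show "(\<lambda>x. norm (h x) * norm (k x)) \<in> borel_measurable M"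
    using assms by (auto simp: L2_def)
  have "norm (h x) * norm (k x) \<le> (norm (h x))\<^sup>2 + (norm (k x))\<^sup>2" for x
    using sum_squares_bound[of "norm (h x)" "norm (k x)"]
      mult_nonneg_nonneg[OF norm_ge_zero norm_ge_zero, of "h x" "k x"] by linarith
  then show "AE x in M. norm (norm (h x) * norm (k x)) \<le> norm ((norm (h x))\<^sup>2 + (norm (k x))\<^sup>2)"
    by auto
qed

lemma Cauchy_Schwarz_L2:
  assumes h: "h \<in> L2 M" and k: "k \<in> L2 M"
  shows "(\<integral>x. norm (h x) * norm (k x) \<partial>M) \<le> norm_L2 M h * norm_L2 M k"
proof -
  let ?X = "\<integral>x. norm (h x) * norm (k x) \<partial>M"
  let ?A = "(norm_L2 M h)\<^sup>2" and ?B = "(norm_L2 M k)\<^sup>2"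
  note int = integrable_norm_mult_norm_L2[OF h k]
  \<comment> \<open>The quadratic \<open>t \<mapsto> \<parallel>|h| - t |k|\<parallel>\<^sup>2\<close> is nonnegative, so its discriminant is not positive.\<close>
  have "0 \<le> ?A - 2 * t * ?X + t\<^sup>2 * ?B" for t
  proof -
    have "0 \<le> (\<integral>x. (norm (h x) - t * norm (k x))\<^sup>2 \<partial>M)"
      by simp
    also have "\<dots> = (\<integral>x. (norm (h x))\<^sup>2 - 2 * t * (norm (h x) * norm (k x)) + t\<^sup>2 * (norm (k x))\<^sup>2 \<partial>M)"
      by (intro Bochner_Integration.integral_cong) (auto simp: power2_diff power_mult_distrib)
    also have "\<dots> = ?A - 2 * t * ?X + t\<^sup>2 * ?B"
      using h k int by (simp add: L2_def norm_L2_power2)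
    finally show ?thesis .
  qed
  note quad = this
  have "?X\<^sup>2 \<le> ?A * ?B"
  proof (cases "?B = 0")
    case True
    have "?X = 0"
    proof (rule ccontr)
      assume "?X \<noteq> 0"
      then show False
        \<comment> \<open>Without its quadratic term, the nonnegative polynomial would be \<open>-1\<close> at this \<open>t\<close>.\<close>
        using quad[of "(?A + 1) / (2 * ?X)"] True by (simp add: field_simps)
    qed
    then show ?thesis
      by simp
  next
    case False
    then have "0 < ?B"
      by (simp add: zero_less_power2)
    moreover have "x\<^sup>2 \<le> a * b" if "0 < b" "0 \<le> a - 2 * (x / b) * x + (x / b)\<^sup>2 * b" for a b x :: real
    proof -
      have "a - 2 * (x / b) * x + (x / b)\<^sup>2 * b = a - x\<^sup>2 / b"
        using that(1) by (simp add: field_simps power2_eq_square)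
      then have "x\<^sup>2 / b \<le> a"
        using that(2) by linarith
      then show ?thesis
        using that(1) by (simp add: pos_divide_le_eq)
    qed
    ultimately show ?thesis
      \<comment> \<open>The quotient \<open>?X / ?B\<close> is the minimiser of the quadratic.\<close>
      using quad[of "?X / ?B"] by blast
  qed
  then have "?X\<^sup>2 \<le> (norm_L2 M h * norm_L2 M k)\<^sup>2"
    by (simp add: power_mult_distrib)
  then show ?thesis
    by (rule power2_le_imp_le) (simp add: norm_L2_nonneg)
qed

lemma integrable_inner_L2:
  assumes "h \<in> L2 M" "k \<in> L2 M"
  shows "integrable M (\<lambda>x. h x \<bullet> k x)"
  using integrable_norm_mult_norm_L2[OF assms] assms
  by (elim Bochner_Integration.integrable_bound) (auto simp: L2_def Cauchy_Schwarz_ineq2)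

lemma abs_integral_inner_L2_le:
  assumes "h \<in> L2 M" "k \<in> L2 M"
  shows "\<bar>\<integral>x. h x \<bullet> k x \<partial>M\<bar> \<le> norm_L2 M h * norm_L2 M k"
proof -
  have "\<bar>\<integral>x. h x \<bullet> k x \<partial>M\<bar> \<le> (\<integral>x. \<bar>h x \<bullet> k x\<bar> \<partial>M)"
    using integral_norm_bound[of M "\<lambda>x. h x \<bullet> k x"] by simp
  also have "\<dots> \<le> (\<integral>x. norm (h x) * norm (k x) \<partial>M)"
    using assms by (intro integral_mono integrable_abs integrable_inner_L2
        integrable_norm_mult_norm_L2 Cauchy_Schwarz_ineq2)
  also have "\<dots> \<le> norm_L2 M h * norm_L2 M k"
    by (rule Cauchy_Schwarz_L2[OF assms])
  finally show ?thesis .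
qed

lemma norm_L2_triangle:
  fixes h k :: "'a \<Rightarrow> 'b::euclidean_space"
  assumes h: "h \<in> L2 M" and k: "k \<in> L2 M"
  shows "norm_L2 M (\<lambda>x. h x + k x) \<le> norm_L2 M h + norm_L2 M k"
proof (rule power2_le_imp_le)
  have "(norm_L2 M (\<lambda>x. h x + k x))\<^sup>2
      = (\<integral>x. (norm (h x))\<^sup>2 + (norm (k x))\<^sup>2 + 2 * (h x \<bullet> k x) \<partial>M)"
    unfolding norm_L2_power2
    by (intro Bochner_Integration.integral_cong)
       (auto simp: power2_norm_eq_inner inner_add_left inner_add_right inner_commute)
  also have "\<dots> = (norm_L2 M h)\<^sup>2 + (norm_L2 M k)\<^sup>2 + 2 * (\<integral>x. h x \<bullet> k x \<partial>M)"
    using h k integrable_inner_L2[OF h k] by (simp add: L2_def norm_L2_power2)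
  also have "\<dots> \<le> (norm_L2 M h + norm_L2 M k)\<^sup>2"
    using abs_integral_inner_L2_le[OF h k] by (simp add: power2_sum)
  finally show "(norm_L2 M (\<lambda>x. h x + k x))\<^sup>2 \<le> (norm_L2 M h + norm_L2 M k)\<^sup>2" .
qed (simp add: norm_L2_nonneg)

lemma norm_L2_scaleR: "norm_L2 M (\<lambda>x. c *\<^sub>R h x) = \<bar>c\<bar> * norm_L2 M h"
  by (simp add: norm_L2_def power_mult_distrib real_sqrt_mult)

lemma norm_L2_diff_le:
  assumes "h \<in> L2 M" "k \<in> L2 M"
  shows "norm_L2 M (\<lambda>x. h x - k x) \<le> norm_L2 M h + norm_L2 M k"
  using norm_L2_triangle[OF assms(1) L2_scaleR[OF assms(2), of "-1"]]
    norm_L2_scaleR[of M "-1" k] by simp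

text \<open>Both convergences demanded of a solution, continuity and differentiability in \<open>L\<^sup>2\<close>, are
  derived from pointwise statements through this form of dominated convergence. The exceptional
  null set must not depend on \<open>s\<close>, hence the quantifier over \<open>s\<close> under the almost-everywhere
  quantifier.\<close>

lemma tendsto_norm_L2_dominated:
  fixes h :: "real \<Rightarrow> 'a \<Rightarrow> 'b::euclidean_space"
  assumes \<phi>: "\<phi> \<in> L2 M"
    and meas: "\<And>s. s \<in> I - {t} \<Longrightarrow> h s \<in> borel_measurable M"
    and lim: "AE x in M. ((\<lambda>s. h s x) \<longlongrightarrow> 0) (at t within I)"
    and bound: "AE x in M. \<forall>s\<in>I - {t}. norm (h s x) \<le> norm (\<phi> x)"
  shows "((\<lambda>s. norm_L2 M (h s)) \<longlongrightarrow> 0) (at t within I)"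
  unfolding tendsto_at_iff_sequentially comp_def
proof (intro allI impI)
  fix X assume X: "\<forall>i. X i \<in> I - {t}" "X \<longlonglongrightarrow> t"
  have "(\<lambda>i. \<integral>x. (norm (h (X i) x))\<^sup>2 \<partial>M) \<longlonglongrightarrow> (\<integral>x. 0 \<partial>M)"
  proof (rule integral_dominated_convergence[where w="\<lambda>x. (norm (\<phi> x))\<^sup>2"])
    show "integrable M (\<lambda>x. (norm (\<phi> x))\<^sup>2)"
      using \<phi> by (simp add: L2_def)
    show "(\<lambda>x. (norm (h (X i) x))\<^sup>2) \<in> borel_measurable M" for i
      using meas X(1) by simp
    show "AE x in M. (\<lambda>i. (norm (h (X i) x))\<^sup>2) \<longlonglongrightarrow> 0"
      using lim
    proof eventually_elim
      case (elim x)
      then have "(\<lambda>i. h (X i) x) \<longlonglongrightarrow> 0"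
        using X unfolding tendsto_at_iff_sequentially comp_def by blast
      then show ?case
        using tendsto_power[OF tendsto_norm, of "\<lambda>i. h (X i) x" 0 sequentially 2] by simp
    qed
    show "AE x in M. norm ((norm (h (X i) x))\<^sup>2) \<le> (norm (\<phi> x))\<^sup>2" for i
      using bound by eventually_elim (use X in \<open>auto intro: power_mono\<close>)
  qed auto
  then show "(\<lambda>i. norm_L2 M (h (X i))) \<longlonglongrightarrow> 0"
    unfolding norm_L2_def using tendsto_real_sqrt by fastforce
qed

section \<open>Differentiating curves of square-integrable functions\<close>

lemma has_L2_derivative_diff:
  assumes "has_L2_derivative M u du t I" "has_L2_derivative M v dv t I"
    and u: "\<And>s. s \<in> I \<Longrightarrow> u s \<in> L2 M" and v: "\<And>s. s \<in> I \<Longrightarrow> v s \<in> L2 M" and t: "t \<in> I"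
  shows "has_L2_derivative M (\<lambda>s x. u s x - v s x) (\<lambda>x. du x - dv x) t I"
  unfolding has_L2_derivative_def
proof
  have du: "du \<in> L2 M" and dv: "dv \<in> L2 M"
    using assms by (auto simp: has_L2_derivative_def)
  then show "(\<lambda>x. du x - dv x) \<in> L2 M"
    by (rule L2_diff)
  let ?q = "\<lambda>w dw s x. (w s x - w t x) /\<^sub>R (s - t) - dw x"
  have lim: "((\<lambda>s. norm_L2 M (?q u du s) + norm_L2 M (?q v dv s)) \<longlongrightarrow> 0) (at t within I)"
    using assms(1,2) by (intro tendsto_add_zero) (simp_all add: has_L2_derivative_def)
  have le: "norm_L2 M (\<lambda>x. (u s x - v s x - (u t x - v t x)) /\<^sub>R (s - t) - (du x - dv x))
      \<le> norm_L2 M (?q u du s) + norm_L2 M (?q v dv s)" if "s \<in> I" for s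
  proof -
    have "?q u du s \<in> L2 M" "?q v dv s \<in> L2 M"
      using u v du dv that t by (auto intro!: L2_diff L2_scaleR)
    from norm_L2_diff_le[OF this] show ?thesis
      by (simp add: algebra_simps)
  qed
  show "((\<lambda>s. norm_L2 M (\<lambda>x. (u s x - v s x - (u t x - v t x)) /\<^sub>R (s - t)
      - (du x - dv x))) \<longlongrightarrow> 0) (at t within I)"
  proof (rule Lim_null_comparison[OF _ lim])
    show "\<forall>\<^sub>F s in at t within I. norm (norm_L2 M (\<lambda>x. (u s x - v s x - (u t x - v t x)) /\<^sub>R (s - t)
        - (du x - dv x))) \<le> norm_L2 M (?q u du s) + norm_L2 M (?q v dv s)"
      unfolding eventually_at_filter real_norm_def abs_of_nonneg[OF norm_L2_nonneg]
      using le by (intro always_eventually) blast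
  qed
qed

text \<open>The square of a Hilbert norm is smooth: with the difference quotient \<open>q s\<close> one has
  \<open>\<parallel>w s\<parallel>\<^sup>2 - \<parallel>w t\<parallel>\<^sup>2 = 2 (s - t) \<langle>q s, w t\<rangle> + (s - t)\<^sup>2 \<parallel>q s\<parallel>\<^sup>2\<close>, and after division by \<open>s - t\<close>
  the last term vanishes in the limit because \<open>q s\<close> converges. This turns uniqueness into a
  scalar differential inequality.\<close>

lemma has_real_derivative_norm_L2_power2:
  assumes deriv: "has_L2_derivative M w dw t I"
    and w: "\<And>s. s \<in> I \<Longrightarrow> w s \<in> L2 M" and t: "t \<in> I"
  shows "((\<lambda>s. (norm_L2 M (w s))\<^sup>2) has_real_derivative 2 * (\<integral>x. dw x \<bullet> w t x \<partial>M)) (at t within I)"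
proof -
  let ?q = "\<lambda>s x. (w s x - w t x) /\<^sub>R (s - t)"
  have dw: "dw \<in> L2 M" and lim: "((\<lambda>s. norm_L2 M (\<lambda>x. ?q s x - dw x)) \<longlongrightarrow> 0) (at t within I)"
    using deriv by (auto simp: has_L2_derivative_def)
  have q: "?q s \<in> L2 M" if "s \<in> I" for s
    using w that t by (auto intro!: L2_diff L2_scaleR)
  have "((\<lambda>s. (\<integral>x. ?q s x \<bullet> w t x \<partial>M) - (\<integral>x. dw x \<bullet> w t x \<partial>M)) \<longlongrightarrow> 0) (at t within I)"
  proof (rule Lim_null_comparison)
    have "norm ((\<integral>x. ?q s x \<bullet> w t x \<partial>M) - (\<integral>x. dw x \<bullet> w t x \<partial>M))
        \<le> norm_L2 M (\<lambda>x. ?q s x - dw x) * norm_L2 M (w t)" if "s \<in> I" for s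
    proof -
      have "(\<integral>x. ?q s x \<bullet> w t x \<partial>M) - (\<integral>x. dw x \<bullet> w t x \<partial>M)
          = (\<integral>x. ?q s x \<bullet> w t x - dw x \<bullet> w t x \<partial>M)"
        by (intro Bochner_Integration.integral_diff[symmetric] integrable_inner_L2 q w t dw that)
      also have "\<dots> = (\<integral>x. (?q s x - dw x) \<bullet> w t x \<partial>M)"
        by (simp add: inner_diff_left)
      finally show ?thesis
        using abs_integral_inner_L2_le[OF L2_diff[OF q[OF that] dw] w[OF t]] by simp
    qed
    then show "\<forall>\<^sub>F s in at t within I. norm ((\<integral>x. ?q s x \<bullet> w t x \<partial>M) - (\<integral>x. dw x \<bullet> w t x \<partial>M))
        \<le> norm_L2 M (\<lambda>x. ?q s x - dw x) * norm_L2 M (w t)"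
      by (simp add: eventually_at_filter)
    show "((\<lambda>s. norm_L2 M (\<lambda>x. ?q s x - dw x) * norm_L2 M (w t)) \<longlongrightarrow> 0) (at t within I)"
      using tendsto_mult_right[OF lim, of "norm_L2 M (w t)"] by simp
  qed
  then have cross: "((\<lambda>s. \<integral>x. ?q s x \<bullet> w t x \<partial>M) \<longlongrightarrow> (\<integral>x. dw x \<bullet> w t x \<partial>M)) (at t within I)"
    by (rule LIM_zero_cancel)
  have quad: "((\<lambda>s. (s - t) * (norm_L2 M (?q s))\<^sup>2) \<longlongrightarrow> 0) (at t within I)"
  proof (rule Lim_null_comparison)
    have "norm ((s - t) * (norm_L2 M (?q s))\<^sup>2)
        \<le> \<bar>s - t\<bar> * (norm_L2 M (\<lambda>x. ?q s x - dw x) + norm_L2 M dw)\<^sup>2" if "s \<in> I" for s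
      using norm_L2_triangle[OF L2_diff[OF q[OF that] dw] dw]
      by (auto simp: abs_mult norm_L2_nonneg intro!: mult_left_mono power_mono)
    then show "\<forall>\<^sub>F s in at t within I. norm ((s - t) * (norm_L2 M (?q s))\<^sup>2)
        \<le> \<bar>s - t\<bar> * (norm_L2 M (\<lambda>x. ?q s x - dw x) + norm_L2 M dw)\<^sup>2"
      by (simp add: eventually_at_filter)
    have "((\<lambda>s. \<bar>s - t\<bar> * (norm_L2 M (\<lambda>x. ?q s x - dw x) + norm_L2 M dw)\<^sup>2)
        \<longlongrightarrow> \<bar>t - t\<bar> * (0 + norm_L2 M dw)\<^sup>2) (at t within I)"
      by (intro tendsto_intros lim)
    then show "((\<lambda>s. \<bar>s - t\<bar> * (norm_L2 M (\<lambda>x. ?q s x - dw x) + norm_L2 M dw)\<^sup>2) \<longlongrightarrow> 0) (at t within I)"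
      by simp
  qed
  have quot: "((norm_L2 M (w s))\<^sup>2 - (norm_L2 M (w t))\<^sup>2) / (s - t)
      = 2 * (\<integral>x. ?q s x \<bullet> w t x \<partial>M) + (s - t) * (norm_L2 M (?q s))\<^sup>2" if "s \<in> I" "s \<noteq> t" for s
  proof -
    have "(norm_L2 M (w s))\<^sup>2 = (\<integral>x. (norm (w t x))\<^sup>2 + 2 * (s - t) * (?q s x \<bullet> w t x)
        + (s - t)\<^sup>2 * (norm (?q s x))\<^sup>2 \<partial>M)"
      unfolding norm_L2_power2
    proof (intro Bochner_Integration.integral_cong refl)
      fix x
      have "w s x = w t x + (s - t) *\<^sub>R ?q s x"
        using that by simp
      then have "(norm (w s x))\<^sup>2 = (norm (w t x + (s - t) *\<^sub>R ?q s x))\<^sup>2"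
        by simp
      then show "(norm (w s x))\<^sup>2 = (norm (w t x))\<^sup>2 + 2 * (s - t) * (?q s x \<bullet> w t x)
          + (s - t)\<^sup>2 * (norm (?q s x))\<^sup>2"
        unfolding power2_norm_eq_inner inner_add_left inner_add_right
        by (simp add: inner_commute power2_eq_square algebra_simps)
    qed
    also have "\<dots> = (norm_L2 M (w t))\<^sup>2 + 2 * (s - t) * (\<integral>x. ?q s x \<bullet> w t x \<partial>M)
        + (s - t)\<^sup>2 * (norm_L2 M (?q s))\<^sup>2"
    proof -
      have i: "integrable M (\<lambda>x. (norm (w t x))\<^sup>2)" "integrable M (\<lambda>x. (norm (?q s x))\<^sup>2)"
        using w[OF t] q[OF that(1)] by (auto simp: L2_def)
      have "integrable M (\<lambda>x. ?q s x \<bullet> w t x)"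
        by (rule integrable_inner_L2[OF q[OF that(1)] w[OF t]])
      with i show ?thesis
        unfolding norm_L2_power2 by (subst Bochner_Integration.integral_add; simp)+
    qed
    finally show ?thesis
      using that by (simp add: field_simps power2_eq_square)
  qed
  have "((\<lambda>s. 2 * (\<integral>x. ?q s x \<bullet> w t x \<partial>M) + (s - t) * (norm_L2 M (?q s))\<^sup>2)
      \<longlongrightarrow> 2 * (\<integral>x. dw x \<bullet> w t x \<partial>M) + 0) (at t within I)"
    by (intro tendsto_intros cross quad)
  then have "((\<lambda>s. 2 * (\<integral>x. ?q s x \<bullet> w t x \<partial>M) + (s - t) * (norm_L2 M (?q s))\<^sup>2)
      \<longlongrightarrow> 2 * (\<integral>x. dw x \<bullet> w t x \<partial>M)) (at t within I)"
    by simp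
  then have "((\<lambda>s. ((norm_L2 M (w s))\<^sup>2 - (norm_L2 M (w t))\<^sup>2) / (s - t))
      \<longlongrightarrow> 2 * (\<integral>x. dw x \<bullet> w t x \<partial>M)) (at t within I)"
  proof (rule Lim_transform_eventually)
    show "\<forall>\<^sub>F s in at t within I. 2 * (\<integral>x. ?q s x \<bullet> w t x \<partial>M) + (s - t) * (norm_L2 M (?q s))\<^sup>2
        = ((norm_L2 M (w s))\<^sup>2 - (norm_L2 M (w t))\<^sup>2) / (s - t)"
      unfolding eventually_at_filter using quot[symmetric] by (intro always_eventually) blast
  qed
  then show ?thesis
    by (simp add: has_field_derivative_iff)
qed

text \<open>Gronwall's argument: \<open>E t * exp (- B * t)\<close> decreases on the right of \<open>0\<close>, and
  \<open>E t * exp (B * t)\<close> increases on the left of \<open>0\<close>.\<close>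

lemma Gronwall_two_sided_zero:
  fixes E E' :: "real \<Rightarrow> real"
  assumes deriv: "\<And>t. t \<in> {-T..T} \<Longrightarrow> (E has_real_derivative E' t) (at t within {-T..T})"
    and growth: "\<And>t. t \<in> {-T..T} \<Longrightarrow> \<bar>E' t\<bar> \<le> B * E t"
    and "E 0 = 0" and t: "t \<in> {-T..T}"
  shows "E t \<le> 0"
proof -
  have cont: "continuous_on {-T..T} E"
    using deriv by (meson DERIV_continuous continuous_on_eq_continuous_within)
  have dint: "(E has_real_derivative E' s) (at s)" if "-T < s" "s < T" for s
    using deriv[of s] that at_within_interior[of s "{-T..T}"] by simp
  show ?thesis
  proof (cases "0 \<le> t")
    case True
    have "E t * exp (- B * t) \<le> E 0 * exp (- B * 0)"
    proof (rule DERIV_nonpos_imp_decreasing_open[OF True])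
      fix s assume s: "0 < s" "s < t"
      then have st: "-T < s" "s < T" using t by auto
      have "((\<lambda>s. E s * exp (- B * s)) has_real_derivative (E' s - B * E s) * exp (- B * s)) (at s)"
        by (rule derivative_eq_intros dint st refl | simp add: algebra_simps)+
      moreover have "(E' s - B * E s) * exp (- B * s) \<le> 0"
        using growth[of s] st by (intro mult_nonpos_nonneg) auto
      ultimately show "\<exists>y. ((\<lambda>s. E s * exp (- B * s)) has_real_derivative y) (at s) \<and> y \<le> 0"
        by blast
    next
      show "continuous_on {0..t} (\<lambda>s. E s * exp (- B * s))"
        using t by (intro continuous_intros continuous_on_subset[OF cont]) auto
    qed
    then show ?thesis
      using \<open>E 0 = 0\<close> by (simp add: mult_le_0_iff)
  next
    case False
    have "E t * exp (B * t) \<le> E 0 * exp (B * 0)"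
    proof (rule DERIV_nonneg_imp_increasing_open[of t 0])
      show "t \<le> 0"
        using False by simp
    next
      fix s assume s: "t < s" "s < 0"
      then have st: "-T < s" "s < T" using t by auto
      have "((\<lambda>s. E s * exp (B * s)) has_real_derivative (E' s + B * E s) * exp (B * s)) (at s)"
        by (rule derivative_eq_intros dint st refl | simp add: algebra_simps)+
      moreover have "0 \<le> (E' s + B * E s) * exp (B * s)"
        using growth[of s] st by (intro mult_nonneg_nonneg) auto
      ultimately show "\<exists>y. ((\<lambda>s. E s * exp (B * s)) has_real_derivative y) (at s) \<and> 0 \<le> y"
        by blast
    next
      show "continuous_on {t..0} (\<lambda>s. E s * exp (B * s))"
        using t by (intro continuous_intros continuous_on_subset[OF cont]) auto
    qed
    then show ?thesis
      using \<open>E 0 = 0\<close> by (simp add: mult_le_0_iff)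
  qed
qed

section \<open>Primitives of continuous curves\<close>

text \<open>This is the integral of \<open>h\<close> from \<open>0\<close> to \<open>t\<close>, transported to the unit interval. In this form
  both signs of \<open>t\<close> are treated alike, and measurable dependence on \<open>t\<close> and on further parameters
  is that of an integral over a fixed domain.\<close>

definition primitive :: "(real \<Rightarrow> 'b) \<Rightarrow> real \<Rightarrow> 'b::euclidean_space" where
  "primitive h t = t *\<^sub>R (LBINT \<theta>:{0..1}. h (t * \<theta>))"

lemma primitive_0 [simp]: "primitive h 0 = 0"
  by (simp add: primitive_def)

lemma set_integrable_unit_interval:
  fixes h :: "real \<Rightarrow> 'b::euclidean_space"
  assumes "continuous_on UNIV h"
  shows "set_integrable lborel {0..1} (\<lambda>\<theta>. h (t * \<theta>))"
  by (intro borel_integrable_atLeastAtMost' continuous_on_compose2[OF assms] continuous_intros) auto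

lemma primitive_has_vector_derivative:
  fixes h :: "real \<Rightarrow> 'b::euclidean_space"
  assumes cont: "continuous_on UNIV h"
  shows "(primitive h has_vector_derivative h t) (at t)"
proof -
  have "isCont h x" for x
    using cont by (simp add: continuous_on_eq_continuous_at)
  then obtain H where H: "\<And>x. (H has_vector_derivative h x) (at x)"
    using einterval_antiderivative[of "-\<infinity>" "\<infinity>" h] by auto
  have "primitive h t = H t - H 0" for t
  proof -
    have "(LBINT \<theta>. indicat_real {0..1} \<theta> *\<^sub>R (t *\<^sub>R h (t * \<theta>))) = H (t * 1) - H (t * 0)"
    proof (rule integral_FTC_atLeastAtMost)
      show "((\<lambda>\<theta>. H (t * \<theta>)) has_vector_derivative t *\<^sub>R h (t * \<theta>)) (at \<theta> within {0..1})" for \<theta>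
      proof -
        have "((\<lambda>\<theta>. t * \<theta>) has_vector_derivative t) (at \<theta>)"
          unfolding has_real_derivative_iff_has_vector_derivative[symmetric]
          by (auto intro!: derivative_eq_intros)
        from vector_diff_chain_at[OF this H] show ?thesis
          by (simp add: o_def has_vector_derivative_at_within)
      qed
      show "continuous_on {0..1} (\<lambda>\<theta>. t *\<^sub>R h (t * \<theta>))"
        by (intro continuous_intros continuous_on_compose2[OF cont]) auto
    qed auto
    then have "(LBINT \<theta>. t *\<^sub>R (indicat_real {0..1} \<theta> *\<^sub>R h (t * \<theta>))) = H t - H 0"
      by (simp add: mult.commute)
    then show ?thesis
      unfolding primitive_def set_lebesgue_integral_def by (subst (asm) integral_scaleR_right) simp
  qed
  then have "primitive h = (\<lambda>t. H t - H 0)"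
    by blast
  then show ?thesis
    using has_vector_derivative_diff[OF H has_vector_derivative_const] by simp
qed

lemma primitive_diff:
  fixes h k :: "real \<Rightarrow> 'b::euclidean_space"
  assumes "continuous_on UNIV h" "continuous_on UNIV k"
  shows "primitive h t - primitive k t = primitive (\<lambda>s. h s - k s) t"
  unfolding primitive_def
  by (subst set_integral_diff(2)[OF assms[THEN set_integrable_unit_interval]])
     (simp add: scaleR_diff_right)

text \<open>Each integration raises the power of \<open>\<bar>t\<bar>\<close> by one and divides by the new exponent; repeated
  use produces the factorials that make the Picard series converge on all of \<open>\<real>\<close>.\<close>

lemma norm_primitive_le_power:
  fixes h :: "real \<Rightarrow> 'b::euclidean_space"
  assumes cont: "continuous_on UNIV h" and bound: "\<And>s. norm (h s) \<le> c * \<bar>s\<bar> ^ n"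
  shows "norm (primitive h t) \<le> c * \<bar>t\<bar> ^ Suc n / Suc n"
proof -
  have int: "integrable lborel (\<lambda>\<theta>. indicat_real {0..1} \<theta> *\<^sub>R h (t * \<theta>))"
    using set_integrable_unit_interval[OF cont] by (simp add: set_integrable_def)
  have intp: "integrable lborel (\<lambda>\<theta>. \<theta> ^ n * indicat_real {0..1} \<theta>)"
    using borel_integrable_atLeastAtMost'[of 0 1 "\<lambda>\<theta>::real. \<theta> ^ n"]
    by (simp add: set_integrable_def mult.commute continuous_intros)
  have "norm (LBINT \<theta>:{0..1}. h (t * \<theta>)) \<le> (LBINT \<theta>. c * \<bar>t\<bar> ^ n * (\<theta> ^ n * indicat_real {0..1} \<theta>))"
    unfolding set_lebesgue_integral_def
  proof (rule norm_integral_le[OF int])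
    show "integrable lborel (\<lambda>\<theta>. c * \<bar>t\<bar> ^ n * (\<theta> ^ n * indicat_real {0..1} \<theta>))"
      using intp by simp
    show "norm (indicat_real {0..1} \<theta> *\<^sub>R h (t * \<theta>)) \<le> c * \<bar>t\<bar> ^ n * (\<theta> ^ n * indicat_real {0..1} \<theta>)" for \<theta>
      using bound[of "t * \<theta>"] by (auto simp: indicator_def abs_mult power_mult_distrib mult.assoc)
  qed
  also have "\<dots> = c * \<bar>t\<bar> ^ n * (1 / Suc n)"
    using integral_power[of 0 1 n] by simp
  finally have "norm (LBINT \<theta>:{0..1}. h (t * \<theta>)) \<le> c * \<bar>t\<bar> ^ n * (1 / Suc n)" .
  from mult_left_mono[OF this abs_ge_zero[of t]] show ?thesis
    by (simp add: primitive_def mult_ac)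
qed

lemma primitive_tendsto:
  fixes h :: "nat \<Rightarrow> real \<Rightarrow> 'b::euclidean_space"
  assumes cont: "\<And>n. continuous_on UNIV (h n)" "continuous_on UNIV h'"
    and lim: "\<And>s. (\<lambda>n. h n s) \<longlonglongrightarrow> h' s"
    and bound: "\<And>n s. \<bar>s\<bar> \<le> \<bar>t\<bar> \<Longrightarrow> norm (h n s) \<le> c"
  shows "(\<lambda>n. primitive (h n) t) \<longlonglongrightarrow> primitive h' t"
  unfolding primitive_def set_lebesgue_integral_def
proof (intro tendsto_scaleR tendsto_const integral_dominated_convergence[where w="\<lambda>\<theta>. indicat_real {0..1} \<theta> *\<^sub>R c"])
  show "(\<lambda>\<theta>. indicat_real {0..1} \<theta> *\<^sub>R h n (t * \<theta>)) \<in> borel_measurable lborel"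
    "(\<lambda>\<theta>. indicat_real {0..1} \<theta> *\<^sub>R h' (t * \<theta>)) \<in> borel_measurable lborel" for n
    using set_integrable_unit_interval[where t=t, OF cont(1)]
      set_integrable_unit_interval[where t=t, OF cont(2)]
    unfolding set_integrable_def by (blast intro: borel_measurable_integrable)+
  show "integrable lborel (\<lambda>\<theta>::real. indicat_real {0..1} \<theta> *\<^sub>R c)"
    by auto
  show "AE \<theta> in lborel. (\<lambda>n. indicat_real {0..1} \<theta> *\<^sub>R h n (t * \<theta>)) \<longlonglongrightarrow> indicat_real {0..1} \<theta> *\<^sub>R h' (t * \<theta>)"
    by (intro AE_I2 tendsto_scaleR tendsto_const lim)
  show "AE \<theta> in lborel. norm (indicat_real {0..1} \<theta> *\<^sub>R h n (t * \<theta>)) \<le> indicat_real {0..1} \<theta> *\<^sub>R c" for n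
  proof (rule AE_I2)
    fix \<theta>
    have "\<bar>t * \<theta>\<bar> \<le> \<bar>t\<bar>" if "\<theta> \<in> {0..1}"
      using that by (auto simp: abs_mult mult_left_le)
    then show "norm (indicat_real {0..1} \<theta> *\<^sub>R h n (t * \<theta>)) \<le> indicat_real {0..1} \<theta> *\<^sub>R c"
      using bound[of "t * \<theta>" n] by (auto simp: indicator_def)
  qed
qed


section \<open>Lipschitz estimates for the velocity and uniqueness\<close>

text \<open>The estimates are measure-theoretic and are therefore set over a finite measure space. The constant
  \<open>Wb\<close> stands for the value of \<open>W_bar\<close> as a real number.\<close>

locale coupled_equation = finite_measure M
  for M :: "'a measure" +
  fixes W :: "'a \<times> 'a \<Rightarrow> real"
    and f :: "real \<Rightarrow> 'b::euclidean_space \<Rightarrow> 'b"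
    and D :: "'b \<Rightarrow> 'b \<Rightarrow> 'b"
    and Wb L_f L_D :: real
  assumes W_L2: "W \<in> L2 (M \<Otimes>\<^sub>M M)"
    and Wb_nonneg: "0 \<le> Wb"
    and AE_row_le: "AE x in M. (\<integral>\<^sup>+ y. ennreal \<bar>W (x, y)\<bar> \<partial>M) \<le> ennreal Wb"
    and f_continuous: "continuous_on UNIV (\<lambda>(t, u). f t u)"
    and D_continuous: "continuous_on UNIV (\<lambda>(u, v). D u v)"
    and L_f_nonneg: "0 \<le> L_f" and L_D_nonneg: "0 \<le> L_D"
    and f_Lipschitz: "\<And>t u u'. norm (f t u - f t u') \<le> L_f * norm (u - u')"
    and D_Lipschitz: "\<And>u v u' v'. norm (D u v - D u' v') \<le> L_D * (norm (u - u') + norm (v - v'))"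
    and D_bounded: "\<And>u v. norm (D u v) \<le> 1"
begin

text \<open>The right-hand side of the evolution equation, as a time-dependent vector field on functions.\<close>

definition velocity :: "real \<Rightarrow> ('a \<Rightarrow> 'b) \<Rightarrow> 'a \<Rightarrow> 'b" where
  "velocity t h x = f t (h x) + (\<integral>y. W (x, y) *\<^sub>R D (h x) (h y) \<partial>M)"

definition row_norm :: "'a \<Rightarrow> real" where
  "row_norm x = norm_L2 M (\<lambda>y. W (x, y))"

text \<open>The points at which the integral in the equation is controlled. Fixing one set of full measure,
  for all times and all functions at once, allows pointwise arguments in \<open>t\<close>.\<close>

definition good :: "'a set" where
  "good = {x \<in> space M. (\<integral>\<^sup>+ y. ennreal ((W (x, y))\<^sup>2) \<partial>M) < \<infinity>
                      \<and> (\<integral>\<^sup>+ y. ennreal \<bar>W (x, y)\<bar> \<partial>M) \<le> ennreal Wb}"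

lemma W_measurable [measurable]: "W \<in> borel_measurable (M \<Otimes>\<^sub>M M)"
  using W_L2 by (simp add: L2_def)

lemma f_measurable [measurable]: "case_prod f \<in> borel_measurable (borel \<Otimes>\<^sub>M borel)"
  using borel_measurable_continuous_onI[OF f_continuous] by (simp add: borel_prod)

lemma D_measurable [measurable]: "case_prod D \<in> borel_measurable (borel \<Otimes>\<^sub>M borel)"
  using borel_measurable_continuous_onI[OF D_continuous] by (simp add: borel_prod)

lemma good_in_sets [measurable]: "good \<in> sets M"
  unfolding good_def by measurable

lemma good_subset: "x \<in> good \<Longrightarrow> x \<in> space M"
  by (simp add: good_def)

sublocale pair: pair_sigma_finite M M ..

lemma integrable_W2: "integrable (M \<Otimes>\<^sub>M M) (\<lambda>z. (W z)\<^sup>2)"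
  using W_L2 by (simp add: L2_def)

lemma AE_good: "AE x in M. x \<in> good"
proof -
  have "AE x in M. integrable M (\<lambda>y. (W (x, y))\<^sup>2)"
    using pair.AE_integrable_fst'[OF integrable_W2] by simp
  then have "AE x in M. (\<integral>\<^sup>+ y. ennreal ((W (x, y))\<^sup>2) \<partial>M) < \<infinity>"
    by eventually_elim (simp add: integrable_iff_bounded)
  then show ?thesis
    using AE_row_le AE_space by eventually_elim (simp add: good_def)
qed

text \<open>The row norms are square-integrable because, by Fubini's theorem, their squares integrate to
  \<open>\<parallel>W\<parallel>\<^sup>2\<close>. Together with \<open>row_integral_mult_le\<close> this is the Hilbert--Schmidt estimate for the integral
  operator with kernel \<open>\<bar>W\<bar>\<close>.\<close>

lemma row_norm_L2: "row_norm \<in> L2 M"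
proof -
  have "row_norm \<in> borel_measurable M"
    unfolding row_norm_def norm_L2_def by measurable
  moreover have "integrable M (\<lambda>x. \<integral>y. (W (x, y))\<^sup>2 \<partial>M)"
    using pair.integrable_fst'[OF integrable_W2] by simp
  ultimately show ?thesis
    by (simp add: L2_def row_norm_def norm_L2_def)
qed

lemma row_norm_nonneg: "0 \<le> row_norm x"
  by (simp add: row_norm_def norm_L2_nonneg)

context
  fixes x assumes x: "x \<in> good"
begin

lemma row_L2: "(\<lambda>y. W (x, y)) \<in> L2 M"
proof -
  have [measurable]: "(\<lambda>y. W (x, y)) \<in> borel_measurable M"
    using good_subset[OF x] by measurable
  show ?thesis
    using x by (simp add: L2_def integrable_iff_bounded good_def)
qed

lemma row_integrable: "integrable M (\<lambda>y. W (x, y))"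
proof (rule Bochner_Integration.integrable_bound)
  show "integrable M (\<lambda>y. norm (W (x, y)) * norm (1::real))"
    by (rule integrable_norm_mult_norm_L2[OF row_L2 L2_const])
  show "(\<lambda>y. W (x, y)) \<in> borel_measurable M"
    using row_L2 by (simp add: L2_def)
qed simp

lemma row_integral_le: "(\<integral>y. \<bar>W (x, y)\<bar> \<partial>M) \<le> Wb"
proof -
  have "ennreal (\<integral>y. \<bar>W (x, y)\<bar> \<partial>M) = (\<integral>\<^sup>+ y. ennreal \<bar>W (x, y)\<bar> \<partial>M)"
    using row_integrable by (intro nn_integral_eq_integral[symmetric]) auto
  also have "\<dots> \<le> ennreal Wb"
    using x by (simp add: good_def)
  finally show ?thesis
    using Wb_nonneg by simp
qed

lemma row_integral_mult_le:
  fixes k :: "'a \<Rightarrow> 'c::euclidean_space"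
  assumes "k \<in> L2 M"
  shows "integrable M (\<lambda>y. \<bar>W (x, y)\<bar> * norm (k y))"
    and "(\<integral>y. \<bar>W (x, y)\<bar> * norm (k y) \<partial>M) \<le> row_norm x * norm_L2 M k"
  using integrable_norm_mult_norm_L2[OF row_L2 assms] Cauchy_Schwarz_L2[OF row_L2 assms]
  by (simp_all add: row_norm_def)

lemma coupling_integrable:
  assumes [measurable]: "h \<in> borel_measurable M"
  shows "integrable M (\<lambda>y. W (x, y) *\<^sub>R D c (h y))"
proof (rule Bochner_Integration.integrable_bound[OF row_integrable])
  have [measurable]: "(\<lambda>y. W (x, y)) \<in> borel_measurable M"
    using row_integrable by auto
  show "(\<lambda>y. W (x, y) *\<^sub>R D c (h y)) \<in> borel_measurable M"
    by measurable
  show "AE y in M. norm (W (x, y) *\<^sub>R D c (h y)) \<le> norm (W (x, y))"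
    using D_bounded by (simp add: mult_left_le)
qed

lemma coupling_bounded:
  assumes "h \<in> borel_measurable M"
  shows "norm (\<integral>y. W (x, y) *\<^sub>R D c (h y) \<partial>M) \<le> Wb"
proof -
  have "norm (\<integral>y. W (x, y) *\<^sub>R D c (h y) \<partial>M) \<le> (\<integral>y. \<bar>W (x, y)\<bar> \<partial>M)"
    using D_bounded row_integrable
    by (intro norm_integral_le coupling_integrable assms) (auto simp: mult_left_le)
  with row_integral_le show ?thesis
    by simp
qed

text \<open>Since \<open>D\<close> is bounded by \<open>1\<close>, the integral term is at most the row integral of \<open>\<bar>W\<bar>\<close>, so
  growth in \<open>h\<close> comes from \<open>f\<close> alone.\<close>

lemma velocity_growth:
  assumes "h \<in> borel_measurable M"
  shows "norm (velocity t h x) \<le> norm (f t 0) + L_f * norm (h x) + Wb"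
proof -
  have "norm (f t (h x)) \<le> norm (f t 0) + L_f * norm (h x)"
    using norm_triangle_ineq[of "f t 0" "f t (h x) - f t 0"] f_Lipschitz[of t "h x" 0] by simp
  then show ?thesis
    unfolding velocity_def using coupling_bounded[OF assms, of "h x"]
    by (intro order_trans[OF norm_triangle_ineq]) linarith
qed

text \<open>The estimate behind both existence and uniqueness. The Lipschitz bound for \<open>D\<close> splits the
  integral term: the difference at \<open>x\<close> is multiplied by the row integral of \<open>\<bar>W\<bar>\<close>, and the
  differences at \<open>y\<close> are integrated against \<open>\<bar>W (x, y)\<bar>\<close>, where the Cauchy--Schwarz inequality
  applies.\<close>

lemma velocity_Lipschitz:
  assumes h: "h \<in> L2 M" and h': "h' \<in> L2 M"
  shows "norm (velocity t h x - velocity t h' x)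
    \<le> (L_f + L_D * Wb) * norm (h x - h' x) + L_D * row_norm x * norm_L2 M (\<lambda>y. h y - h' y)"
proof -
  let ?d = "norm (h x - h' x)"
  let ?I = "\<lambda>h. \<integral>y. W (x, y) *\<^sub>R D (h x) (h y) \<partial>M"
  have hm: "h \<in> borel_measurable M" "h' \<in> borel_measurable M"
    using h h' by (auto simp: L2_def)
  note row = row_integral_mult_le[OF L2_diff[OF h h']]
  have "norm (?I h - ?I h') = norm (\<integral>y. W (x, y) *\<^sub>R D (h x) (h y) - W (x, y) *\<^sub>R D (h' x) (h' y) \<partial>M)"
    by (subst Bochner_Integration.integral_diff) (auto intro: coupling_integrable hm)
  also have "\<dots> \<le> (\<integral>y. L_D * ?d * \<bar>W (x, y)\<bar> + L_D * (\<bar>W (x, y)\<bar> * norm (h y - h' y)) \<partial>M)"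
  proof (rule norm_integral_le)
    show "integrable M (\<lambda>y. W (x, y) *\<^sub>R D (h x) (h y) - W (x, y) *\<^sub>R D (h' x) (h' y))"
      by (intro Bochner_Integration.integrable_diff coupling_integrable hm)
    show "integrable M (\<lambda>y. L_D * ?d * \<bar>W (x, y)\<bar> + L_D * (\<bar>W (x, y)\<bar> * norm (h y - h' y)))"
      using row(1) row_integrable by auto
    show "norm (W (x, y) *\<^sub>R D (h x) (h y) - W (x, y) *\<^sub>R D (h' x) (h' y))
        \<le> L_D * ?d * \<bar>W (x, y)\<bar> + L_D * (\<bar>W (x, y)\<bar> * norm (h y - h' y))" for y
      using mult_left_mono[OF D_Lipschitz[of "h x" "h y" "h' x" "h' y"] abs_ge_zero, of "W (x, y)"]
      unfolding scaleR_diff_right[symmetric] norm_scaleR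
      by (simp add: algebra_simps)
  qed
  also have "\<dots> = L_D * ?d * (\<integral>y. \<bar>W (x, y)\<bar> \<partial>M) + L_D * (\<integral>y. \<bar>W (x, y)\<bar> * norm (h y - h' y) \<partial>M)"
    using row(1) row_integrable by simp
  also have "\<dots> \<le> L_D * ?d * Wb + L_D * (row_norm x * norm_L2 M (\<lambda>y. h y - h' y))"
    using row(2) row_integral_le L_D_nonneg by (intro add_mono mult_left_mono) auto
  finally have I: "norm (?I h - ?I h') \<le> \<dots>" .
  have "velocity t h x - velocity t h' x = (f t (h x) - f t (h' x)) + (?I h - ?I h')"
    by (simp add: velocity_def)
  then have "norm (velocity t h x - velocity t h' x) \<le> norm (f t (h x) - f t (h' x)) + norm (?I h - ?I h')"
    by (simp add: norm_triangle_ineq)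
  also have "\<dots> \<le> L_f * ?d + (L_D * ?d * Wb + L_D * (row_norm x * norm_L2 M (\<lambda>y. h y - h' y)))"
    by (rule add_mono[OF f_Lipschitz I])
  finally show ?thesis
    by (simp add: algebra_simps)
qed

text \<open>Pointwise convergence suffices: as \<open>D\<close> is bounded, \<open>\<bar>W (x, \<cdot>)\<bar>\<close> dominates the integrands,
  whatever the size of \<open>h n\<close>.\<close>

lemma velocity_tendsto:
  assumes t: "t \<longlonglongrightarrow> t'" and h: "\<And>y. (\<lambda>n. h n y) \<longlonglongrightarrow> h' y"
    and meas: "\<And>n. h n \<in> borel_measurable M"
  shows "(\<lambda>n. velocity (t n) (h n) x) \<longlonglongrightarrow> velocity t' h' x"
  unfolding velocity_def
proof (rule tendsto_add)
  have "isCont (\<lambda>(t, u). f t u) (t', h' x)"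
    using f_continuous by (simp add: continuous_on_eq_continuous_at)
  from isCont_tendsto_compose[OF this tendsto_Pair[OF t h]]
  show "(\<lambda>n. f (t n) (h n x)) \<longlonglongrightarrow> f t' (h' x)"
    by simp
  have meas': "h' \<in> borel_measurable M"
    using borel_measurable_LIMSEQ_metric[OF meas h] .
  show "(\<lambda>n. \<integral>y. W (x, y) *\<^sub>R D (h n x) (h n y) \<partial>M) \<longlonglongrightarrow> (\<integral>y. W (x, y) *\<^sub>R D (h' x) (h' y) \<partial>M)"
  proof (rule integral_dominated_convergence[where w="\<lambda>y. \<bar>W (x, y)\<bar>"])
    show "integrable M (\<lambda>y. \<bar>W (x, y)\<bar>)"
      using row_integrable by simp
    show "(\<lambda>y. W (x, y) *\<^sub>R D (h n x) (h n y)) \<in> borel_measurable M" for n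
      by (rule borel_measurable_integrable[OF coupling_integrable[OF meas]])
    show "(\<lambda>y. W (x, y) *\<^sub>R D (h' x) (h' y)) \<in> borel_measurable M"
      by (rule borel_measurable_integrable[OF coupling_integrable[OF meas']])
    show "AE y in M. (\<lambda>n. W (x, y) *\<^sub>R D (h n x) (h n y)) \<longlonglongrightarrow> W (x, y) *\<^sub>R D (h' x) (h' y)"
    proof (intro AE_I2 tendsto_scaleR tendsto_const)
      fix y
      have "isCont (\<lambda>(u, v). D u v) (h' x, h' y)"
        using D_continuous by (simp add: continuous_on_eq_continuous_at)
      from isCont_tendsto_compose[OF this tendsto_Pair[OF h h]]
      show "(\<lambda>n. D (h n x) (h n y)) \<longlonglongrightarrow> D (h' x) (h' y)"
        by simp
    qed
    show "AE y in M. norm (W (x, y) *\<^sub>R D (h n x) (h n y)) \<le> \<bar>W (x, y)\<bar>" for n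
      using D_bounded by (simp add: mult_left_le)
  qed
qed

lemma velocity_continuous:
  fixes u :: "real \<Rightarrow> 'a \<Rightarrow> 'b"
  assumes meas: "\<And>t. u t \<in> borel_measurable M"
    and cont: "\<And>y. continuous_on UNIV (\<lambda>t. u t y)"
  shows "continuous_on UNIV (\<lambda>t. velocity t (u t) x)"
  unfolding continuous_on_sequentially comp_def
  using cont by (auto intro!: velocity_tendsto meas simp: continuous_on_sequentially comp_def)

end

lemma velocity_measurable_pair:
  assumes [measurable]: "case_prod u \<in> borel_measurable (borel \<Otimes>\<^sub>M M)"
  shows "(\<lambda>(t, x). velocity t (u t) x) \<in> borel_measurable (borel \<Otimes>\<^sub>M M)"
  unfolding velocity_def by measurable

lemma velocity_measurable:
  assumes [measurable]: "h \<in> borel_measurable M"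
  shows "velocity t h \<in> borel_measurable M"
  unfolding velocity_def by measurable

lemma ivp_solution_alt:
  "ivp_solution M W f D g T u \<longleftrightarrow> continuous_on_L2 M {-T..T} u \<and>
     (\<forall>t\<in>{-T..T}. has_L2_derivative M u (velocity t (u t)) t {-T..T}) \<and> (AE x in M. u 0 x = g x)"
  by (simp add: ivp_solution_def velocity_def[abs_def])

text \<open>For the difference \<open>w\<close> of two solutions, \<open>E t = \<parallel>w t\<parallel>\<^sup>2\<close> has derivative \<open>2 \<langle>w', w\<rangle>\<close>. The
  pointwise Lipschitz estimate and the Cauchy--Schwarz inequality, used for the pair
  \<open>row_norm\<close>, \<open>w t\<close>, give \<open>\<bar>E'\<bar> \<le> 2 B E\<close>, and Gronwall's argument applies.\<close>

lemma ivp_solution_unique: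
  assumes u: "ivp_solution M W f D g T u" and v: "ivp_solution M W f D g T v" and t: "t \<in> {-T..T}"
  shows "AE x in M. v t x = u t x"
proof -
  define w where "w s x = v s x - u s x" for s x
  define dw where "dw s x = velocity s (v s) x - velocity s (u s) x" for s x
  define B where "B = (L_f + L_D * Wb) + L_D * norm_L2 M row_norm"
  let ?I = "{-T..T}"
  have uL2: "u s \<in> L2 M" and vL2: "v s \<in> L2 M" if "s \<in> ?I" for s
    using u v that by (auto simp: ivp_solution_def continuous_on_L2_def)
  have wL2: "w s \<in> L2 M" if "s \<in> ?I" for s
    unfolding w_def using L2_diff[OF vL2 uL2] that by blast
  have deriv: "has_L2_derivative M w (dw s) s ?I" if "s \<in> ?I" for s
    unfolding w_def dw_def
    using u v that uL2 vL2 by (intro has_L2_derivative_diff) (auto simp: ivp_solution_alt)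
  have growth: "\<bar>2 * (\<integral>x. dw s x \<bullet> w s x \<partial>M)\<bar> \<le> 2 * B * (norm_L2 M (w s))\<^sup>2" if s: "s \<in> ?I" for s
  proof -
    let ?N = "norm_L2 M (w s)"
    have dwL2: "dw s \<in> L2 M"
      using deriv[OF s] by (simp add: has_L2_derivative_def)
    note intw = integrable_norm_mult_norm_L2[OF row_norm_L2 wL2[OF s]]
    have intw2: "integrable M (\<lambda>x. (norm (w s x))\<^sup>2)"
      using wL2[OF s] by (simp add: L2_def)
    have "\<bar>\<integral>x. dw s x \<bullet> w s x \<partial>M\<bar> \<le> (\<integral>x. norm (dw s x \<bullet> w s x) \<partial>M)"
      using integral_norm_bound[of M "\<lambda>x. dw s x \<bullet> w s x"] by simp
    also have "\<dots> \<le> (\<integral>x. (L_f + L_D * Wb) * (norm (w s x))\<^sup>2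
        + L_D * ?N * (norm (row_norm x) * norm (w s x)) \<partial>M)"
    proof (rule integral_mono_AE)
      show "integrable M (\<lambda>x. norm (dw s x \<bullet> w s x))"
        by (intro integrable_norm integrable_inner_L2 dwL2 wL2 s)
      show "integrable M (\<lambda>x. (L_f + L_D * Wb) * (norm (w s x))\<^sup>2
          + L_D * ?N * (norm (row_norm x) * norm (w s x)))"
        using intw intw2 by (intro Bochner_Integration.integrable_add integrable_mult_right) auto
      show "AE x in M. norm (dw s x \<bullet> w s x)
          \<le> (L_f + L_D * Wb) * (norm (w s x))\<^sup>2 + L_D * ?N * (norm (row_norm x) * norm (w s x))"
        using AE_good
      proof eventually_elim
        case (elim x)
        have "norm (dw s x \<bullet> w s x) \<le> norm (dw s x) * norm (w s x)"
          using Cauchy_Schwarz_ineq2 by simp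
        also have "\<dots> \<le> ((L_f + L_D * Wb) * norm (w s x) + L_D * row_norm x * ?N) * norm (w s x)"
          using velocity_Lipschitz[OF elim vL2[OF s] uL2[OF s], of s]
          by (intro mult_right_mono) (auto simp: dw_def w_def[abs_def])
        also have "\<dots> = (L_f + L_D * Wb) * (norm (w s x))\<^sup>2 + L_D * ?N * (norm (row_norm x) * norm (w s x))"
          by (simp add: algebra_simps power2_eq_square row_norm_nonneg)
        finally show ?case .
      qed
    qed
    also have "\<dots> = (L_f + L_D * Wb) * ?N\<^sup>2 + L_D * ?N * (\<integral>x. norm (row_norm x) * norm (w s x) \<partial>M)"
      using intw intw2 by (subst Bochner_Integration.integral_add) (auto simp: norm_L2_power2)
    also have "\<dots> \<le> (L_f + L_D * Wb) * ?N\<^sup>2 + L_D * ?N * (norm_L2 M row_norm * ?N)"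
      using Cauchy_Schwarz_L2[OF row_norm_L2 wL2[OF s]] L_D_nonneg
      by (intro add_left_mono mult_left_mono mult_nonneg_nonneg norm_L2_nonneg) auto
    also have "\<dots> = B * ?N\<^sup>2"
      by (simp add: B_def algebra_simps power2_eq_square)
    finally show ?thesis
      by simp
  qed
  have "0 \<in> ?I"
    using t by auto
  have "AE x in M. w 0 x = 0"
    using u v unfolding ivp_solution_def w_def by auto
  then have "(norm_L2 M (w 0))\<^sup>2 = 0"
    unfolding norm_L2_power2 by (intro integral_eq_zero_AE) auto
  then have "(norm_L2 M (w t))\<^sup>2 \<le> 0"
    using Gronwall_two_sided_zero[OF has_real_derivative_norm_L2_power2[OF deriv wL2] growth _ t] by blast
  then have "(\<integral>x. (norm (w t x))\<^sup>2 \<partial>M) = 0"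
    by (simp add: norm_L2_power2 antisym)
  then have "AE x in M. (norm (w t x))\<^sup>2 = 0"
    using wL2[OF t] by (subst (asm) integral_nonneg_eq_0_iff_AE) (auto simp: L2_def)
  then show ?thesis
    by (simp add: w_def)
qed

end


section \<open>Existence by weighted Picard iteration\<close>

text \<open>The bound on \<open>f t 0\<close> is uniform over all \<open>t\<close>, so that the iteration runs on the whole real
  line, without restricting time to an interval.\<close>

locale coupled_ivp = coupled_equation M W f D Wb L_f L_D
  for M :: "'a measure" and W and f :: "real \<Rightarrow> 'b::euclidean_space \<Rightarrow> 'b"
    and D and Wb L_f L_D :: real +
  fixes g :: "'a \<Rightarrow> 'b" and C :: real
  assumes g_L2: "g \<in> L2 M" and f_zero_bounded: "\<And>t. norm (f t 0) \<le> C"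
begin

text \<open>The space of functions bounded by a multiple of \<open>weight\<close> replaces \<open>L\<^sup>2\<close> in the iteration:
  estimates become pointwise in \<open>x\<close>. The summand \<open>norm (g x)\<close> brings the initial value into this
  space, \<open>1\<close> brings in the constants of the growth bound, and \<open>row_norm x\<close> makes the integral
  operator with kernel \<open>\<bar>W\<bar>\<close> act on it.\<close>

definition weight :: "'a \<Rightarrow> real" where
  "weight x = 1 + norm (g x) + row_norm x"

text \<open>The last two summands and \<open>L_f\<close> give the Lipschitz constant in the weighted supremum norm;
  the first three bound the velocity at the initial value relative to \<open>weight\<close>, so
  that one constant serves for every step of the iteration.\<close>

definition rate :: real where
  "rate = C + L_f + Wb + L_D * Wb + L_D * norm_L2 M weight"

lemma weight_ge: "1 \<le> weight x" "norm (g x) \<le> weight x" "row_norm x \<le> weight x"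
  using row_norm_nonneg[of x] by (auto simp: weight_def)

lemma weight_nonneg: "0 \<le> weight x"
  using weight_ge(1)[of x] by simp

lemma weight_L2: "weight \<in> L2 M"
  unfolding weight_def[abs_def]
  by (intro L2_add L2_const L2_norm g_L2 row_norm_L2)

lemma C_nonneg: "0 \<le> C"
  using order_trans[OF norm_ge_zero f_zero_bounded] .

lemma rate_nonneg: "0 \<le> rate"
  unfolding rate_def using C_nonneg L_f_nonneg Wb_nonneg L_D_nonneg norm_L2_nonneg[of M weight]
  by (intro add_nonneg_nonneg mult_nonneg_nonneg)

lemma velocity_le_weight:
  assumes x: "x \<in> good" and h: "h \<in> borel_measurable M" "norm (h x) \<le> B * weight x"
  shows "norm (velocity t h x) \<le> (C + L_f * B + Wb) * weight x"
proof -
  have "norm (velocity t h x) \<le> C + L_f * norm (h x) + Wb"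
    using velocity_growth[OF x h(1), of t] f_zero_bounded[of t] by linarith
  also have "\<dots> \<le> C * weight x + L_f * (B * weight x) + Wb * weight x"
    using mult_left_mono[OF weight_ge(1)[of x] C_nonneg] mult_left_mono[OF weight_ge(1)[of x] Wb_nonneg]
      mult_left_mono[OF h(2) L_f_nonneg] by simp
  finally show ?thesis
    by (simp add: algebra_simps)
qed

lemma velocity_g_le:
  assumes x: "x \<in> good"
  shows "norm (velocity t g x) \<le> rate * weight x"
proof -
  have "norm (velocity t g x) \<le> (C + L_f * 1 + Wb) * weight x"
    using g_L2 weight_ge(2)[of x] by (intro velocity_le_weight x) (auto simp: L2_def)
  also have "\<dots> \<le> rate * weight x"
    using weight_nonneg[of x] L_D_nonneg Wb_nonneg norm_L2_nonneg[of M weight]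
    by (intro mult_right_mono) (auto simp: rate_def)
  finally show ?thesis .
qed

text \<open>A pointwise bound by \<open>c * weight\<close> bounds the \<open>L\<^sup>2\<close> distance by \<open>c\<close> times the norm of \<open>weight\<close>,
  and the factor \<open>row_norm x\<close> in the Lipschitz estimate is at most \<open>weight x\<close>: the weighted
  bound reproduces itself.\<close>

lemma velocity_weighted_Lipschitz:
  assumes x: "x \<in> good" and h: "h \<in> L2 M" and h': "h' \<in> L2 M"
    and c: "0 \<le> c" and le: "\<And>y. norm (h y - h' y) \<le> c * weight y"
  shows "norm (velocity t h x - velocity t h' x) \<le> rate * c * weight x"
proof -
  have "norm_L2 M (\<lambda>y. h y - h' y) \<le> norm_L2 M (\<lambda>y. c *\<^sub>R weight y)"
    using le L2_diff[OF h h'] c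
    by (intro norm_L2_mono L2_scaleR weight_L2) (auto simp: L2_def abs_mult abs_of_nonneg[OF weight_nonneg])
  then have N: "norm_L2 M (\<lambda>y. h y - h' y) \<le> c * norm_L2 M weight"
    using c by (simp add: norm_L2_scaleR del: real_scaleR_def)
  have "norm (velocity t h x - velocity t h' x)
      \<le> (L_f + L_D * Wb) * norm (h x - h' x) + L_D * row_norm x * norm_L2 M (\<lambda>y. h y - h' y)"
    by (rule velocity_Lipschitz[OF x h h'])
  also have "\<dots> \<le> (L_f + L_D * Wb) * (c * weight x) + L_D * weight x * (c * norm_L2 M weight)"
    using L_f_nonneg L_D_nonneg Wb_nonneg le N weight_ge[of x] norm_L2_nonneg
    by (intro add_mono mult_mono mult_left_mono) auto
  also have "\<dots> = (L_f + L_D * Wb + L_D * norm_L2 M weight) * (c * weight x)"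
    by (simp add: algebra_simps)
  also have "\<dots> \<le> rate * (c * weight x)"
    using c weight_ge(1)[of x] C_nonneg Wb_nonneg
    by (intro mult_right_mono mult_nonneg_nonneg) (auto simp: rate_def)
  finally show ?thesis
    by (simp add: mult.assoc)
qed

text \<open>At the points that are not good the iterates stay at the initial value. Thus every iterate is
  continuous in \<open>t\<close> at every point, not just at almost every one.\<close>

primrec picard :: "nat \<Rightarrow> real \<Rightarrow> 'a \<Rightarrow> 'b" where
  "picard 0 t x = g x"
| "picard (Suc n) t x = g x + primitive (\<lambda>s. indicat_real good x *\<^sub>R velocity s (picard n s) x) t"

lemma picard_good:
  "x \<in> good \<Longrightarrow> picard (Suc n) t x = g x + primitive (\<lambda>s. velocity s (picard n s) x) t"
  by simp

lemma picard_not_good: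
  assumes "x \<notin> good"
  shows "picard n t x = g x"
  using assms by (cases n) (auto simp: primitive_def)

lemma picard_measurable_pair: "case_prod (picard n) \<in> borel_measurable (borel \<Otimes>\<^sub>M M)"
proof (induction n)
  case 0
  have [measurable]: "g \<in> borel_measurable M"
    using g_L2 by (simp add: L2_def)
  show ?case
    by simp
next
  case (Suc n)
  have [measurable]: "g \<in> borel_measurable M"
    using g_L2 by (simp add: L2_def)
  note [measurable] = velocity_measurable_pair[OF Suc]
  have "(\<lambda>p. case (fst (fst p) * snd p, snd (fst p)) of (t, x) \<Rightarrow> velocity t (picard n t) x)
      \<in> borel_measurable ((borel \<Otimes>\<^sub>M M) \<Otimes>\<^sub>M lborel)"
    by measurable
  then have [measurable]: "(\<lambda>p. velocity (fst (fst p) * snd p) (picard n (fst (fst p) * snd p)) (snd (fst p)))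
      \<in> borel_measurable ((borel \<Otimes>\<^sub>M M) \<Otimes>\<^sub>M lborel)"
    by simp
  have "(\<lambda>q. g (snd q) + fst q *\<^sub>R (\<integral>\<theta>. indicat_real {0..1} \<theta> *\<^sub>R indicat_real good (snd q)
      *\<^sub>R velocity (fst q * \<theta>) (picard n (fst q * \<theta>)) (snd q) \<partial>lborel)) \<in> borel_measurable (borel \<Otimes>\<^sub>M M)"
  proof -
    have "(\<lambda>q. \<integral>\<theta>. indicat_real {0..1} \<theta> *\<^sub>R indicat_real good (snd q)
      *\<^sub>R velocity (fst q * \<theta>) (picard n (fst q * \<theta>)) (snd q) \<partial>lborel) \<in> borel_measurable (borel \<Otimes>\<^sub>M M)"
      by (rule lborel.borel_measurable_lebesgue_integral) (simp add: split_beta')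
    then show ?thesis
      by measurable
  qed
  then show ?case
    by (simp add: split_beta' primitive_def set_lebesgue_integral_def)
qed

lemma picard_measurable: "picard n t \<in> borel_measurable M"
  using measurable_compose[OF measurable_Pair1' picard_measurable_pair, of t n] by simp

lemma picard_continuous: "continuous_on UNIV (\<lambda>t. picard n t x)"
proof (induction n arbitrary: x)
  case (Suc n)
  show ?case
  proof (cases "x \<in> good")
    case True
    have "(primitive (\<lambda>s. velocity s (picard n s) x) has_vector_derivative velocity t (picard n t) x) (at t)" for t
      by (intro primitive_has_vector_derivative velocity_continuous True picard_measurable Suc.IH)
    then have "continuous_on UNIV (primitive (\<lambda>s. velocity s (picard n s) x))"
      by (meson continuous_at_imp_continuous_on has_vector_derivative_continuous)
    then show ?thesis
      using True by (simp add: continuous_on_add)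
  qed (simp add: primitive_def)
qed simp

lemma picard_velocity_continuous: "x \<in> good \<Longrightarrow> continuous_on UNIV (\<lambda>s. velocity s (picard n s) x)"
  by (rule velocity_continuous[OF _ picard_measurable picard_continuous])

text \<open>Square-integrability of the iterates is proved together with the bound on the increments: the
  Lipschitz estimate for the next increment needs the former, and the former passes to the next
  iterate by the latter.\<close>

lemma picard_increment:
  "(\<forall>t. picard n t \<in> L2 M) \<and>
   (\<forall>t x. norm (picard (Suc n) t x - picard n t x) \<le> (rate * \<bar>t\<bar>) ^ Suc n / fact (Suc n) * weight x)"
proof (induction n)
  case 0
  have g: "picard 0 s = g" for s
    by (simp add: fun_eq_iff)
  have "norm (picard (Suc 0) t x - picard 0 t x) \<le> (rate * \<bar>t\<bar>) ^ Suc 0 / fact (Suc 0) * weight x" for t x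
  proof (cases "x \<in> good")
    case True
    have "norm (primitive (\<lambda>s. velocity s (picard 0 s) x) t) \<le> rate * weight x * \<bar>t\<bar> ^ Suc 0 / Suc 0"
      using velocity_g_le[OF True] by (intro norm_primitive_le_power picard_velocity_continuous True) (simp add: g)
    with True show ?thesis
      by (simp add: mult_ac)
  next
    case False
    then show ?thesis
      using rate_nonneg weight_ge(1)[of x] by (simp add: picard_not_good del: picard.simps)
  qed
  moreover have "picard 0 t \<in> L2 M" for t
    using g_L2 by (simp add: g)
  ultimately show ?case
    by blast
next
  case (Suc n)
  define c where "c s = (rate * \<bar>s\<bar>) ^ Suc n / fact (Suc n)" for s
  have c: "0 \<le> c s" for s
    using rate_nonneg by (simp add: c_def)
  have IH: "picard n s \<in> L2 M" "norm (picard (Suc n) s x - picard n s x) \<le> c s * weight x" for s x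
    using Suc by (auto simp: c_def simp del: picard.simps power_Suc fact_Suc)
  have L2': "picard (Suc n) s \<in> L2 M" for s
  proof -
    have "(\<lambda>x. picard (Suc n) s x - picard n s x) \<in> L2 M"
      using IH(2)[of s] c[of s] weight_ge(1)
      by (intro L2_dominated[OF L2_scaleR[OF weight_L2, of "c s"]] borel_measurable_diff picard_measurable)
         (auto simp: abs_mult abs_of_nonneg[OF weight_nonneg] simp del: picard.simps)
    from L2_add[OF this IH(1)[of s]] show ?thesis
      by (simp del: picard.simps)
  qed
  have "norm (picard (Suc (Suc n)) t x - picard (Suc n) t x)
      \<le> (rate * \<bar>t\<bar>) ^ Suc (Suc n) / fact (Suc (Suc n)) * weight x" for t x
  proof (cases "x \<in> good")
    case True
    have "norm (velocity s (picard (Suc n) s) x - velocity s (picard n s) x)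
        \<le> (rate ^ Suc (Suc n) / fact (Suc n) * weight x) * \<bar>s\<bar> ^ Suc n" for s
      using velocity_weighted_Lipschitz[OF True L2' IH(1) c IH(2), of s s]
      by (simp add: c_def power_mult_distrib mult_ac del: picard.simps fact_Suc)
    then have "norm (primitive (\<lambda>s. velocity s (picard (Suc n) s) x - velocity s (picard n s) x) t)
        \<le> (rate ^ Suc (Suc n) / fact (Suc n) * weight x) * \<bar>t\<bar> ^ Suc (Suc n) / Suc (Suc n)"
      by (intro norm_primitive_le_power continuous_on_diff picard_velocity_continuous True)
    moreover have "picard (Suc (Suc n)) t x - picard (Suc n) t x
        = primitive (\<lambda>s. velocity s (picard (Suc n) s) x - velocity s (picard n s) x) t"
      unfolding picard_good[OF True]
      by (simp add: primitive_diff picard_velocity_continuous True del: picard.simps)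
    moreover have "(rate ^ Suc (Suc n) / fact (Suc n) * weight x) * \<bar>t\<bar> ^ Suc (Suc n) / Suc (Suc n)
        = (rate * \<bar>t\<bar>) ^ Suc (Suc n) / fact (Suc (Suc n)) * weight x"
      unfolding fact_Suc[of "Suc n"] power_mult_distrib
      by (simp add: mult_ac del: fact_Suc power_Suc)
    ultimately show ?thesis
      by simp
  next
    case False
    then show ?thesis
      using rate_nonneg weight_ge(1)[of x] by (simp add: picard_not_good del: picard.simps)
  qed
  with L2' show ?case
    by blast
qed

lemma picard_increment_le:
  "norm (picard (Suc n) t x - picard n t x) \<le> (rate * \<bar>t\<bar>) ^ Suc n / fact (Suc n) * weight x"
  using picard_increment by blast

lemma picard_eq_sum: "picard n t x = g x + (\<Sum>i<n. picard (Suc i) t x - picard i t x)"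
  by (subst sum_lessThan_telescope) simp

lemma summable_exp_tail: "summable (\<lambda>n. z ^ Suc n / fact (Suc n) * w)" for z w :: real
  using summable_Suc_iff[of "\<lambda>n. z ^ n / fact n"] summable_exp[of z]
  by (intro summable_mult2) (simp add: field_simps)

text \<open>The initial value accounts for the zeroth term of the exponential series and the increments for
  the following ones.\<close>

lemma norm_picard_le: "norm (picard n t x) \<le> exp (rate * \<bar>t\<bar>) * weight x"
proof -
  let ?a = "\<lambda>i. (rate * \<bar>t\<bar>) ^ i / fact i"
  have "norm (picard n t x) \<le> norm (g x) + (\<Sum>i<n. norm (picard (Suc i) t x - picard i t x))"
    unfolding picard_eq_sum[of n] by (intro order_trans[OF norm_triangle_ineq] add_mono norm_sum order_refl)
  also have "\<dots> \<le> weight x + (\<Sum>i<n. ?a (Suc i) * weight x)"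
    by (intro add_mono weight_ge sum_mono picard_increment_le)
  also have "\<dots> = (\<Sum>i<Suc n. ?a i) * weight x"
    unfolding sum.lessThan_Suc_shift
    by (simp add: sum_distrib_right distrib_right del: fact_Suc power_Suc)
  also have "\<dots> \<le> exp (rate * \<bar>t\<bar>) * weight x"
  proof (rule mult_right_mono)
    have "summable ?a"
      using summable_exp[of "rate * \<bar>t\<bar>"] by (simp add: field_simps)
    then have "(\<Sum>i<Suc n. ?a i) \<le> (\<Sum>i. ?a i)"
      using rate_nonneg by (intro sum_le_suminf) auto
    then show "(\<Sum>i<Suc n. ?a i) \<le> exp (rate * \<bar>t\<bar>)"
      by (simp add: exp_def field_simps)
    show "0 \<le> weight x"
      using weight_nonneg[of x] by simp
  qed
  finally show ?thesis .
qed

definition solution :: "real \<Rightarrow> 'a \<Rightarrow> 'b" where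
  "solution t x = g x + (\<Sum>n. picard (Suc n) t x - picard n t x)"

lemma uniform_limit_picard: "uniform_limit {-R..R} (\<lambda>n t. picard n t x) (\<lambda>t. solution t x) sequentially"
proof -
  have "uniform_limit {-R..R} (\<lambda>n t. \<Sum>i<n. picard (Suc i) t x - picard i t x)
      (\<lambda>t. \<Sum>i. picard (Suc i) t x - picard i t x) sequentially"
  proof (rule Weierstrass_m_test[OF _ summable_exp_tail])
    fix n t assume "t \<in> {-R..R}"
    then have "(rate * \<bar>t\<bar>) ^ Suc n / fact (Suc n) * weight x \<le> (rate * R) ^ Suc n / fact (Suc n) * weight x"
      using rate_nonneg weight_ge(1)[of x]
      by (intro mult_right_mono divide_right_mono power_mono mult_left_mono) auto
    then show "norm (picard (Suc n) t x - picard n t x) \<le> (rate * R) ^ Suc n / fact (Suc n) * weight x"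
      using picard_increment_le order_trans by blast
  qed
  from uniform_limit_add[OF uniform_limit_const this, of "\<lambda>t. g x"] show ?thesis
    unfolding picard_eq_sum[symmetric] solution_def .
qed

lemma picard_tendsto: "(\<lambda>n. picard n t x) \<longlonglongrightarrow> solution t x"
  by (rule tendsto_uniform_limitI[OF uniform_limit_picard[where R="\<bar>t\<bar>"]]) auto

lemma solution_measurable: "solution t \<in> borel_measurable M"
  by (rule borel_measurable_LIMSEQ_metric[OF picard_measurable picard_tendsto])

lemma solution_continuous: "continuous_on UNIV (\<lambda>t. solution t x)"
proof (rule continuous_at_imp_continuous_on, rule ballI)
  fix t :: real
  have "continuous_on {-(\<bar>t\<bar> + 1)..\<bar>t\<bar> + 1} (\<lambda>t. solution t x)"
    by (rule uniform_limit_theorem[OF always_eventually uniform_limit_picard])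
       (auto intro: continuous_on_subset[OF picard_continuous])
  then show "isCont (\<lambda>t. solution t x) t"
    by (rule continuous_on_interior) auto
qed

lemma norm_solution_le: "norm (solution t x) \<le> exp (rate * \<bar>t\<bar>) * weight x"
  by (rule Lim_bounded[OF tendsto_norm[OF picard_tendsto]]) (auto intro: norm_picard_le)

lemma solution_velocity_continuous: "x \<in> good \<Longrightarrow> continuous_on UNIV (\<lambda>s. velocity s (solution s) x)"
  by (rule velocity_continuous[OF _ solution_measurable solution_continuous])

text \<open>Dominated convergence in the time integral; the exponential bound on the iterates is uniform in
  \<open>n\<close>.\<close>

lemma solution_integral_equation:
  assumes x: "x \<in> good"
  shows "solution t x = g x + primitive (\<lambda>s. velocity s (solution s) x) t"
proof (rule LIMSEQ_unique)
  show "(\<lambda>n. picard (Suc n) t x) \<longlonglongrightarrow> solution t x"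
    by (rule LIMSEQ_Suc[OF picard_tendsto])
  show "(\<lambda>n. picard (Suc n) t x) \<longlonglongrightarrow> g x + primitive (\<lambda>s. velocity s (solution s) x) t"
    unfolding picard_good[OF x]
  proof (intro tendsto_add tendsto_const primitive_tendsto)
    show "(\<lambda>n. velocity s (picard n s) x) \<longlonglongrightarrow> velocity s (solution s) x" for s
      by (intro velocity_tendsto x tendsto_const picard_tendsto picard_measurable)
    show "norm (velocity s (picard n s) x) \<le> (C + L_f * exp (rate * \<bar>t\<bar>) + Wb) * weight x"
      if "\<bar>s\<bar> \<le> \<bar>t\<bar>" for n s
    proof (rule velocity_le_weight[OF x picard_measurable])
      have "exp (rate * \<bar>s\<bar>) * weight x \<le> exp (rate * \<bar>t\<bar>) * weight x"
        using that rate_nonneg weight_ge(1)[of x] by (intro mult_right_mono) (auto intro: mult_left_mono)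
      with norm_picard_le show "norm (picard n s x) \<le> exp (rate * \<bar>t\<bar>) * weight x"
        by (rule order_trans)
    qed
  qed (intro picard_velocity_continuous solution_velocity_continuous x)+
qed

lemma solution_has_vector_derivative:
  assumes x: "x \<in> good"
  shows "((\<lambda>t. solution t x) has_vector_derivative velocity t (solution t) x) (at t)"
proof -
  have "(primitive (\<lambda>s. velocity s (solution s) x) has_vector_derivative velocity t (solution t) x) (at t)"
    by (intro primitive_has_vector_derivative solution_velocity_continuous x)
  from has_vector_derivative_add[OF has_vector_derivative_const this, of "g x"]
  show ?thesis
    by (simp add: solution_integral_equation[OF x, symmetric])
qed

text \<open>At every good point the solution is a classical solution of an ordinary differential equation. On
  \<open>{-T..T}\<close> it and its velocity are bounded by multiples of \<open>weight\<close>, and by the mean value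
  inequality so are its difference quotients. Since \<open>weight\<close> is square-integrable, dominated
  convergence turns pointwise continuity and differentiability into the same in \<open>L\<^sup>2\<close>.\<close>

lemma ivp_solution_solution: "ivp_solution M W f D g T solution"
  unfolding ivp_solution_alt
proof (intro conjI ballI)
  let ?I = "{-T..T}"
  define E where "E = exp (rate * T)"
  define Q where "Q = C + L_f * E + Wb"
  have sol_le: "norm (solution t x) \<le> E * weight x" if "t \<in> ?I" for t x
  proof -
    have "exp (rate * \<bar>t\<bar>) * weight x \<le> E * weight x"
      unfolding E_def using that rate_nonneg weight_ge(1)[of x]
      by (intro mult_right_mono) (auto intro: mult_left_mono)
    with norm_solution_le show ?thesis
      by (rule order_trans)
  qed
  have velocity_le: "norm (velocity t (solution t) x) \<le> Q * weight x" if "t \<in> ?I" "x \<in> good" for t x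
    unfolding Q_def by (intro velocity_le_weight that solution_measurable sol_le)
  have sol_L2: "solution t \<in> L2 M" if "t \<in> ?I" for t
    using sol_le[OF that]
    by (intro L2_dominated[OF L2_scaleR[OF weight_L2, of E]] solution_measurable)
       (auto intro: order_trans[OF _ abs_ge_self])
  have velocity_L2: "velocity t (solution t) \<in> L2 M" if "t \<in> ?I" for t
  proof (rule L2_dominated[OF L2_scaleR[OF weight_L2, of Q]])
    show "velocity t (solution t) \<in> borel_measurable M"
      by (intro velocity_measurable solution_measurable)
    show "AE x in M. norm (velocity t (solution t) x) \<le> norm (Q *\<^sub>R weight x)"
      using AE_good by eventually_elim (use velocity_le[OF that] in \<open>auto intro: order_trans[OF _ abs_ge_self]\<close>)
  qed
  show "continuous_on_L2 M ?I solution"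
    unfolding continuous_on_L2_def
  proof (intro conjI ballI sol_L2)
    fix t assume t: "t \<in> ?I"
    show "((\<lambda>s. norm_L2 M (\<lambda>x. solution s x - solution t x)) \<longlongrightarrow> 0) (at t within ?I)"
    proof (rule tendsto_norm_L2_dominated[OF L2_scaleR[OF weight_L2, of "2 * E"]])
      show "(\<lambda>x. solution s x - solution t x) \<in> borel_measurable M" for s
        by (intro borel_measurable_diff solution_measurable)
      show "AE x in M. ((\<lambda>s. solution s x - solution t x) \<longlongrightarrow> 0) (at t within ?I)"
      proof (rule AE_I2)
        fix x
        have "((\<lambda>s. solution s x) \<longlongrightarrow> solution t x) (at t within ?I)"
          using continuous_on_subset[OF solution_continuous, of ?I x] t by (simp add: continuous_on)
        then show "((\<lambda>s. solution s x - solution t x) \<longlongrightarrow> 0) (at t within ?I)"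
          by (rule LIM_zero)
      qed
      show "AE x in M. \<forall>s\<in>?I - {t}. norm (solution s x - solution t x) \<le> norm ((2 * E) *\<^sub>R weight x)"
      proof (intro AE_I2 ballI)
        fix x s assume "s \<in> ?I - {t}"
        then show "norm (solution s x - solution t x) \<le> norm ((2 * E) *\<^sub>R weight x)"
          using norm_triangle_ineq4[of "solution s x" "solution t x"] sol_le[of s x] sol_le[OF t, of x]
            abs_ge_self[of "2 * E * weight x"] by simp
      qed
    qed
  qed
  show "has_L2_derivative M solution (velocity t (solution t)) t ?I" if t: "t \<in> ?I" for t
    unfolding has_L2_derivative_def
  proof (intro conjI velocity_L2 t)
    let ?q = "\<lambda>s x. (solution s x - solution t x) /\<^sub>R (s - t)"
    have quot_le: "norm (?q s x) \<le> Q * weight x" if s: "s \<in> ?I" "s \<noteq> t" and x: "x \<in> good" for s x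
    proof -
      have "norm (solution s x - solution t x) \<le> Q * weight x * norm (s - t)"
      proof (rule differentiable_bound[of ?I])
        show "((\<lambda>t. solution t x) has_derivative (\<lambda>h. h *\<^sub>R velocity r (solution r) x)) (at r within ?I)" for r
          using solution_has_vector_derivative[OF x, of r] has_vector_derivative_at_within
          unfolding has_vector_derivative_def by (blast intro: has_derivative_at_withinI)
        show "onorm (\<lambda>h. h *\<^sub>R velocity r (solution r) x) \<le> Q * weight x" if "r \<in> ?I" for r
          using mult_right_mono[OF velocity_le[OF that x]] by (intro onorm_le) (simp add: mult.commute)
      qed (use s t in auto)
      moreover have "norm (?q s x) = norm (solution s x - solution t x) / norm (s - t)"
        by (simp add: divide_inverse mult.commute)
      ultimately show ?thesis
        using s by (simp add: pos_divide_le_eq)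
    qed
    show "((\<lambda>s. norm_L2 M (\<lambda>x. ?q s x - velocity t (solution t) x)) \<longlongrightarrow> 0) (at t within ?I)"
    proof (rule tendsto_norm_L2_dominated[OF L2_scaleR[OF weight_L2, of "2 * Q"]])
      show "(\<lambda>x. ?q s x - velocity t (solution t) x) \<in> borel_measurable M" for s
        by (intro borel_measurable_diff borel_measurable_scaleR borel_measurable_const
            velocity_measurable solution_measurable)
      show "AE x in M. ((\<lambda>s. ?q s x - velocity t (solution t) x) \<longlongrightarrow> 0) (at t within ?I)"
        using AE_good
      proof eventually_elim
        case (elim x)
        have "((\<lambda>t. solution t x) has_vector_derivative velocity t (solution t) x) (at t within ?I)"
          by (rule has_vector_derivative_at_within[OF solution_has_vector_derivative[OF elim]])
        then have lim: "((\<lambda>s. norm (solution s x - solution t x - (s - t) *\<^sub>R velocity t (solution t) x)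
            / norm (s - t)) \<longlongrightarrow> 0) (at t within ?I)"
          unfolding has_vector_derivative_def has_derivative_iff_norm by (rule conjunct2)
        have "norm (solution s x - solution t x - (s - t) *\<^sub>R velocity t (solution t) x) / norm (s - t)
            = norm (?q s x - velocity t (solution t) x)" if "s \<noteq> t" for s
        proof -
          have "?q s x - velocity t (solution t) x
              = (solution s x - solution t x - (s - t) *\<^sub>R velocity t (solution t) x) /\<^sub>R (s - t)"
            using that by (simp add: scaleR_diff_right)
          then show ?thesis
            by (simp only: norm_scaleR norm_inverse) (simp add: divide_inverse mult.commute)
        qed
        then have "((\<lambda>s. norm (?q s x - velocity t (solution t) x)) \<longlongrightarrow> 0) (at t within ?I)"
          by (intro Lim_transform_eventually[OF lim]) (simp add: eventually_at_filter)
        then show ?case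
          by (rule tendsto_norm_zero_cancel)
      qed
      show "AE x in M. \<forall>s\<in>?I - {t}. norm (?q s x - velocity t (solution t) x) \<le> norm ((2 * Q) *\<^sub>R weight x)"
        using AE_good
      proof eventually_elim
        case (elim x)
        show ?case
        proof
          fix s assume "s \<in> ?I - {t}"
          then have "norm (?q s x) \<le> Q * weight x" "norm (velocity t (solution t) x) \<le> Q * weight x"
            using quot_le velocity_le t elim by auto
          then show "norm (?q s x - velocity t (solution t) x) \<le> norm ((2 * Q) *\<^sub>R weight x)"
            using norm_triangle_ineq4[of "?q s x" "velocity t (solution t) x"]
              abs_ge_self[of "2 * Q * weight x"] by simp
        qed
      qed
    qed
  qed
  show "AE x in M. solution 0 x = g x"
    using AE_good by eventually_elim (simp add: solution_integral_equation)
qed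

end

section \<open>The initial value problem on an attractor\<close>

theorem theorem4p2:
  fixes k :: nat
    and S :: "nat \<Rightarrow> real ^ 'd \<Rightarrow> real ^ 'd"
    and K :: "(real ^ 'd) set"
    and \<nu> :: "(real ^ 'd) measure"
    and W :: "(real ^ 'd) \<times> (real ^ 'd) \<Rightarrow> real"
    and f :: "real \<Rightarrow> real ^ 'q \<Rightarrow> real ^ 'q"
    and D :: "real ^ 'q \<Rightarrow> real ^ 'q \<Rightarrow> real ^ 'q"
    and g :: "real ^ 'd \<Rightarrow> real ^ 'q"
    and L_f L_D T :: real
  assumes "contracting_ifs k S"
    and "is_attractor k S K"
    and "stationary_measure k S K \<nu>"
    and "W \<in> L2 (\<nu> \<Otimes>\<^sub>M \<nu>)"
    and "W_bar \<nu> W < \<infinity>"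
    and "continuous_on UNIV (\<lambda>(t, u). f t u)"
    and "continuous_on UNIV (\<lambda>(u, v). D u v)"
    and "L_f > 0" and "L_D > 0"
    and "\<And>t u u'. norm (f t u - f t u') \<le> L_f * norm (u - u')"
    and "\<And>u v u' v'. norm (D u v - D u' v') \<le> L_D * (norm (u - u') + norm (v - v'))"
    and "\<And>u v. norm (D u v) \<le> 1"
    and "g \<in> L2 \<nu>"
    and "T > 0"
  shows "\<exists>u. ivp_solution \<nu> W f D g T u \<and>
           (\<forall>v. ivp_solution \<nu> W f D g T v \<longrightarrow>
              (\<forall>t\<in>{-T..T}. AE x in \<nu>. v t x = u t x))"
proof -
  interpret prob_space \<nu>
    using assms(3) by (simp add: stationary_measure_def)
  obtain Wb where Wb: "0 \<le> Wb" "W_bar \<nu> W = ennreal Wb"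
    using assms(5) by (cases "W_bar \<nu> W") auto
  have row: "AE x in \<nu>. (\<integral>\<^sup>+ y. ennreal \<bar>W (x, y)\<bar> \<partial>\<nu>) \<le> ennreal Wb"
  proof -
    have "esssup \<nu> (\<lambda>x. \<integral>\<^sup>+ y. ennreal \<bar>W (x, y)\<bar> \<partial>\<nu>) \<le> ennreal Wb"
      using Wb(2) by (simp add: W_bar_def flip: Wb(2))
    with esssup_AE[where M=\<nu> and f="\<lambda>x. \<integral>\<^sup>+ y. ennreal \<bar>W (x, y)\<bar> \<partial>\<nu>"] show ?thesis
      by (auto elim!: eventually_mono)
  qed
  interpret orig: coupled_equation \<nu> W f D Wb L_f L_D
    by unfold_locales (use assms Wb row in auto)
  \<comment> \<open>Freezing the time argument of \<open>f\<close> outside \<open>{-T..T}\<close> changes nothing on that interval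
    and makes \<open>f t 0\<close> bounded, by compactness.\<close>
  define clamp where "clamp t = max (-T) (min T t)" for t
  have clamp: "clamp t \<in> {-T..T}" "t \<in> {-T..T} \<Longrightarrow> clamp t = t" for t
    using assms(14) by (auto simp: clamp_def)
  have f_clamp_continuous: "continuous_on UNIV (\<lambda>(t, u). f (clamp t) u)"
  proof -
    have "continuous_on UNIV (\<lambda>p. (clamp (fst p), snd p :: real ^ 'q))"
      unfolding clamp_def by (intro continuous_intros)
    from continuous_on_compose2[OF assms(6) this] show ?thesis
      by (simp add: split_beta')
  qed
  have "continuous_on {-T..T} (\<lambda>t. f t 0)"
    by (rule continuous_on_compose2[OF assms(6), of "{-T..T}" "\<lambda>t. (t, 0)", simplified])
       (intro continuous_intros)
  then have "compact ((\<lambda>t. f t 0) ` {-T..T})"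
    by (rule compact_continuous_image) simp
  then obtain C where "\<forall>v\<in>(\<lambda>t. f t 0) ` {-T..T}. norm v \<le> C"
    using compact_imp_bounded bounded_iff by metis
  then have C: "norm (f (clamp t) 0) \<le> C" for t
    using clamp(1) by blast
  interpret clamped: coupled_ivp \<nu> W "\<lambda>t. f (clamp t)" D Wb L_f L_D g C
    by unfold_locales (use assms Wb row f_clamp_continuous C in auto)
  have "ivp_solution \<nu> W f D g T clamped.solution"
    using clamped.ivp_solution_solution[of T] clamp(2) unfolding ivp_solution_def by simp
  moreover from this have "\<forall>v. ivp_solution \<nu> W f D g T v \<longrightarrow>
      (\<forall>t\<in>{-T..T}. AE x in \<nu>. v t x = clamped.solution t x)"
    by (intro allI impI ballI) (rule orig.ivp_solution_unique)
  ultimately show ?thesis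
    by (intro exI conjI)
qed

end
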